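(* Let $\mathcal M$ be an internal unital $C^*$-algebra with nonstandard hull $\widehat{\mathcal M}$. (i) Let $v\in\mathrm{Fin}(\mathcal M)$ be such that $\widehat v\in\widehat{\mathcal M}$ is a partial isometry. Then there is a partial isometry $u\in\mathcal M$ such that $u\approx v$. (ii) For any projection $\widehat p\in\widehat{\mathcal M}$ there is a projection $q\in\mathcal M$ such that $\widehat p=\widehat q$. (iii) Given projections $\widehat{p_0},\widehat{q_0}\in\widehat{\mathcal M}$ with $\widehat{p_0}\sim\widehat{q_0}$, there are projections $p,q\in\mathcal M$ such that $\widehat p=\widehat{p_0}$, $\widehat q=\widehat{q_0}$ and $p\sim q$.
   Context: Work in a nonstandard universe (in the sense of Robinson's nonstandard analysis) that is $\kappa$-saturated for a sufficiently large uncountable cardinal $\kappa$. All $C^*$-algebras are unital. An internal $C^*$-algebra $\mathcal M$ is an internal object satisfying (by transfer) the definition of a $C^*$-algebra over ${}^*\mathbb C$, with norm valued in ${}^*\mathbb R$. For $r,s\in{}^*\mathbb R$, $r\approx s$ means $|r-s|<1/n$ for all standard $n\ge 1$; $r$ is finite ($|r|<\infty$) if $|r|<n$ for some standard $n$, and then ${}^\circ r\in\mathbb R$ is its standard part. Put $\mathrm{Fin}(\mathcal M)=\{a\in\mathcal M:\|a\|<\infty\}$; $a\approx b$ means $\|a-b\|\approx 0$; $\widehat a=\{x\in\mathcal M: x\approx a\}$. The nonstandard hull is $\widehat{\mathcal M}=\{\widehat a: a\in\mathrm{Fin}(\mathcal M)\}$ with $\widehat a+\widehat b=\widehat{a+b}$,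 $\widehat a\,\widehat b=\widehat{ab}$, $(\widehat a)^*=\widehat{a^*}$, unit $\widehat 1$, scalar multiplication induced likewise, and $\|\widehat a\|={}^\circ\|a\|$; it is an ordinary $C^*$-algebra. Projections $p,q$ of a $C^*$-algebra are Murray–von Neumann equivalent, $p\sim q$, if $u^*u=p$ and $uu^*=q$ for some partial isometry $u$ in the same algebra (for $\mathcal M$, the internal version of this notion). *)

theory Defs
  imports Complex_Main "HOL-Algebra.Module"
begin

unbundle cardinal_syntax

section \<open>C*-algebras with explicit carrier\<close>

text \<open>
  The types of scalars and of norm values are parameters: the same record holds ordinary
  \<open>C\<^sup>*\<close>-algebras (scalars \<open>complex\<close>, norm values \<open>real\<close>) and internal ones seen from outside
  (scalars in \<open>\<^sup>*\<complex>\<close>, norm values in \<open>\<^sup>*\<real>\<close>).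
\<close>

record ('s, 'r, 'a) cstar = "('s, 'a) module" +
  adj :: "'a \<Rightarrow> 'a"
  alg_norm :: "'a \<Rightarrow> 'r"

definition complex_ring :: "complex ring" where
  "complex_ring = \<lparr>carrier = UNIV, mult = (*), one = 1, zero = 0, add = (+)\<rparr>"

locale cstar_algebra = ring A + scalars: module complex_ring A
  for A :: "(complex, real, 'a) cstar" (structure) +
  assumes smult_mult_left:
      "\<lbrakk>x \<in> carrier A; y \<in> carrier A\<rbrakk> \<Longrightarrow> c \<odot> (x \<otimes> y) = (c \<odot> x) \<otimes> y"
    and smult_mult_right:
      "\<lbrakk>x \<in> carrier A; y \<in> carrier A\<rbrakk> \<Longrightarrow> c \<odot> (x \<otimes> y) = x \<otimes> (c \<odot> y)"
    and adj_closed: "x \<in> carrier A \<Longrightarrow> adj A x \<in> carrier A"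
    and adj_adj: "x \<in> carrier A \<Longrightarrow> adj A (adj A x) = x"
    and adj_add:
      "\<lbrakk>x \<in> carrier A; y \<in> carrier A\<rbrakk> \<Longrightarrow> adj A (x \<oplus> y) = adj A x \<oplus> adj A y"
    and adj_smult: "x \<in> carrier A \<Longrightarrow> adj A (c \<odot> x) = cnj c \<odot> adj A x"
    and adj_mult:
      "\<lbrakk>x \<in> carrier A; y \<in> carrier A\<rbrakk> \<Longrightarrow> adj A (x \<otimes> y) = adj A y \<otimes> adj A x"
    and norm_nonneg: "x \<in> carrier A \<Longrightarrow> 0 \<le> alg_norm A x"
    and norm_eq_zero: "x \<in> carrier A \<Longrightarrow> alg_norm A x = 0 \<longleftrightarrow> x = \<zero>"
    and norm_triangle:
      "\<lbrakk>x \<in> carrier A; y \<in> carrier A\<rbrakk> \<Longrightarrow> alg_norm A (x \<oplus> y) \<le> alg_norm A x + alg_norm A y"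
    and norm_smult: "x \<in> carrier A \<Longrightarrow> alg_norm A (c \<odot> x) = cmod c * alg_norm A x"
    and norm_mult:
      "\<lbrakk>x \<in> carrier A; y \<in> carrier A\<rbrakk> \<Longrightarrow> alg_norm A (x \<otimes> y) \<le> alg_norm A x * alg_norm A y"
    and cstar_identity: "x \<in> carrier A \<Longrightarrow> alg_norm A (adj A x \<otimes> x) = (alg_norm A x)\<^sup>2"
    and complete:
      "\<And>\<sigma> :: nat \<Rightarrow> 'a. \<lbrakk>\<And>n. \<sigma> n \<in> carrier A;
          \<And>e. 0 < e \<Longrightarrow> \<exists>N. \<forall>m\<ge>N. \<forall>n\<ge>N. alg_norm A (\<sigma> m \<ominus> \<sigma> n) < e\<rbrakk>
        \<Longrightarrow> \<exists>x\<in>carrier A. (\<lambda>n. alg_norm A (\<sigma> n \<ominus> x)) \<longlonglongrightarrow> 0"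

definition projection :: "('s, 'r, 'a) cstar \<Rightarrow> 'a \<Rightarrow> bool" where
  "projection A p \<longleftrightarrow> p \<in> carrier A \<and> adj A p = p \<and> p \<otimes>\<^bsub>A\<^esub> p = p"

definition partial_isometry :: "('s, 'r, 'a) cstar \<Rightarrow> 'a \<Rightarrow> bool" where
  "partial_isometry A u \<longleftrightarrow> u \<in> carrier A \<and> projection A (adj A u \<otimes>\<^bsub>A\<^esub> u)"

definition mvn_equivalent :: "('s, 'r, 'a) cstar \<Rightarrow> 'a \<Rightarrow> 'a \<Rightarrow> bool" where
  "mvn_equivalent A p q \<longleftrightarrow>
    (\<exists>u. partial_isometry A u \<and> adj A u \<otimes>\<^bsub>A\<^esub> u = p \<and> u \<otimes>\<^bsub>A\<^esub> adj A u = q)"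


section \<open>Nonstandard universes\<close>

text \<open>
  The type \<open>'v\<close> is the standard universe. It is an arbitrary type that contains (through
  injections) the points of a type \<open>'a\<close>, the complex numbers (and hence the reals) and all
  \<open>C\<^sup>*\<close>-algebra structures on subsets of \<open>'a\<close>; it may contain any other objects, for example
  a whole level of a superstructure over these. The type \<open>'w\<close> consists of the internal objects.
  The map \<open>star\<close> sends a standard object \<open>x\<close> to \<open>\<^sup>*x\<close>, and \<open>star_rel\<close> sends a finitary relation
  \<open>R\<close> on the standard universe (a set of argument lists) to its extension \<open>\<^sup>*R\<close>.
\<close>

record ('a, 'v, 'w) extension =
  emb_point :: "'a \<Rightarrow> 'v"
  emb_num :: "complex \<Rightarrow> 'v"
  emb_alg :: "(complex, real, 'a) cstar \<Rightarrow> 'v"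
  star :: "'v \<Rightarrow> 'w"
  star_rel :: "'v list set \<Rightarrow> 'w list set"

text \<open>First-order formulas, with a relation symbol for every relation on the standard universe.\<close>

datatype 'v fm =
    FRel "'v list set" "nat list"
  | FEq nat nat
  | FNot "'v fm"
  | FAnd "'v fm" "'v fm"
  | FAll nat "'v fm"

primrec sat :: "('v list set \<Rightarrow> 'u list set) \<Rightarrow> 'v fm \<Rightarrow> (nat \<Rightarrow> 'u) \<Rightarrow> bool" where
  "sat I (FRel R is) e \<longleftrightarrow> map e is \<in> I R"
| "sat I (FEq i j) e \<longleftrightarrow> e i = e j"
| "sat I (FNot \<phi>) e \<longleftrightarrow> \<not> sat I \<phi> e"
| "sat I (FAnd \<phi> \<psi>) e \<longleftrightarrow> sat I \<phi> e \<and> sat I \<psi> e"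
| "sat I (FAll i \<phi>) e \<longleftrightarrow> (\<forall>a. sat I \<phi> (e(i := a)))"

text \<open>The last conjunct is the transfer principle; standard parameters enter through \<open>e\<close>.\<close>

definition nonstandard_universe :: "('a, 'v, 'w) extension \<Rightarrow> bool" where
  "nonstandard_universe U \<longleftrightarrow>
    inj (emb_point U) \<and> inj (emb_num U) \<and> inj (emb_alg U) \<and>
    (\<forall>\<phi> e. sat (\<lambda>R. R) \<phi> e \<longleftrightarrow> sat (star_rel U) \<phi> (star U \<circ> e))"

text \<open>
  Sets definable from internal parameters; by the internal definition principle they are internal,
  and if \<open>'v\<close> contains the subsets of a standard set \<open>B\<close>, every internal subset of \<open>\<^sup>*B\<close> has this form.
\<close>

definition internal_set :: "('a, 'v, 'w) extension \<Rightarrow> 'w set \<Rightarrow> bool" where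
  "internal_set U S \<longleftrightarrow> (\<exists>\<phi> e. S = {a. sat (star_rel U) \<phi> (e(0 := a))})"

definition uncountable_cardinal :: "'k rel \<Rightarrow> bool" where
  "uncountable_cardinal \<kappa> \<longleftrightarrow> Card_order \<kappa> \<and> natLeq <o \<kappa>"

definition saturated :: "('a, 'v, 'w) extension \<Rightarrow> 'k rel \<Rightarrow> bool" where
  "saturated U \<kappa> \<longleftrightarrow>
    (\<forall>F. (\<forall>S\<in>F. internal_set U S) \<and> |F| <o \<kappa> \<and> (\<forall>G. G \<subseteq> F \<and> finite G \<longrightarrow> \<Inter>G \<noteq> {})
      \<longrightarrow> \<Inter>F \<noteq> {})"


section \<open>Hyperreal numbers\<close>

abbreviation emb_real :: "('a, 'v, 'w) extension \<Rightarrow> real \<Rightarrow> 'v" where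
  "emb_real U x \<equiv> emb_num U (complex_of_real x)"

definition hless :: "('a, 'v, 'w) extension \<Rightarrow> 'w \<Rightarrow> 'w \<Rightarrow> bool" where
  "hless U r s \<longleftrightarrow> [r, s] \<in> star_rel U {[emb_real U x, emb_real U y] | x y. x < y}"

definition habs :: "('a, 'v, 'w) extension \<Rightarrow> 'w \<Rightarrow> 'w" where
  "habs U r = (THE s. [r, s] \<in> star_rel U {[emb_real U x, emb_real U \<bar>x\<bar>] | x. True})"

definition hminus :: "('a, 'v, 'w) extension \<Rightarrow> 'w \<Rightarrow> 'w \<Rightarrow> 'w" where
  "hminus U r s =
    (THE t. [r, s, t] \<in> star_rel U {[emb_real U x, emb_real U y, emb_real U (x - y)] | x y. True})"

definition hfinite :: "('a, 'v, 'w) extension \<Rightarrow> 'w \<Rightarrow> bool" where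
  "hfinite U r \<longleftrightarrow> (\<exists>n::nat. hless U (habs U r) (star U (emb_real U (real n))))"

definition happrox :: "('a, 'v, 'w) extension \<Rightarrow> 'w \<Rightarrow> 'w \<Rightarrow> bool" where
  "happrox U r s \<longleftrightarrow>
    (\<forall>n::nat. 1 \<le> n \<longrightarrow> hless U (habs U (hminus U r s)) (star U (emb_real U (1 / real n))))"

definition standard_part :: "('a, 'v, 'w) extension \<Rightarrow> 'w \<Rightarrow> real" where
  "standard_part U r = (THE x. happrox U r (star U (emb_real U x)))"


section \<open>Internal C*-algebras\<close>

text \<open>
  An internal object satisfies the transferred definition of a \<open>C\<^sup>*\<close>-algebra iff it belongs to
  \<open>\<^sup>*\<C>\<close>, where \<open>\<C>\<close> is the standard set of all \<open>C\<^sup>*\<close>-algebras (on subsets of \<open>'a\<close>).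
\<close>

definition internal_cstar_algebra :: "('a, 'v, 'w) extension \<Rightarrow> 'w \<Rightarrow> bool" where
  "internal_cstar_algebra U M \<longleftrightarrow> [M] \<in> star_rel U {[emb_alg U A] | A. cstar_algebra A}"

text \<open>
  The carrier and the operations of an internal \<open>C\<^sup>*\<close>-algebra \<open>M\<close>, as an external record over
  \<open>'w\<close>: each operation of \<open>M\<close> is given by the extension of the graph of the corresponding
  operation on standard algebras.
\<close>

definition internal_alg :: "('a, 'v, 'w) extension \<Rightarrow> 'w \<Rightarrow> ('w, 'w, 'w) cstar" where
  "internal_alg U M = \<lparr>
    carrier = {a. [M, a] \<in> star_rel U {[emb_alg U A, emb_point U x] | A x. x \<in> carrier A}},
    mult = (\<lambda>a b. THE c. [M, a, b, c] \<in> star_rel U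
      {[emb_alg U A, emb_point U x, emb_point U y, emb_point U (x \<otimes>\<^bsub>A\<^esub> y)] | A x y. True}),
    one = (THE c. [M, c] \<in> star_rel U {[emb_alg U A, emb_point U \<one>\<^bsub>A\<^esub>] | A. True}),
    zero = (THE c. [M, c] \<in> star_rel U {[emb_alg U A, emb_point U \<zero>\<^bsub>A\<^esub>] | A. True}),
    add = (\<lambda>a b. THE c. [M, a, b, c] \<in> star_rel U
      {[emb_alg U A, emb_point U x, emb_point U y, emb_point U (x \<oplus>\<^bsub>A\<^esub> y)] | A x y. True}),
    smult = (\<lambda>s a. THE c. [M, s, a, c] \<in> star_rel U
      {[emb_alg U A, emb_num U z, emb_point U x, emb_point U (z \<odot>\<^bsub>A\<^esub> x)] | A z x. True}),
    adj = (\<lambda>a. THE c. [M, a, c] \<in> star_rel U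
      {[emb_alg U A, emb_point U x, emb_point U (adj A x)] | A x. True}),
    alg_norm = (\<lambda>a. THE r. [M, a, r] \<in> star_rel U
      {[emb_alg U A, emb_point U x, emb_real U (alg_norm A x)] | A x. True})\<rparr>"


section \<open>The nonstandard hull\<close>

definition Fin :: "('a, 'v, 'w) extension \<Rightarrow> 'w \<Rightarrow> 'w set" where
  "Fin U M = {a \<in> carrier (internal_alg U M). hfinite U (alg_norm (internal_alg U M) a)}"

definition approx :: "('a, 'v, 'w) extension \<Rightarrow> 'w \<Rightarrow> 'w \<Rightarrow> 'w \<Rightarrow> bool" where
  "approx U M a b \<longleftrightarrow>
    happrox U (alg_norm (internal_alg U M) (a \<ominus>\<^bsub>internal_alg U M\<^esub> b)) (star U (emb_real U 0))"

definition hat :: "('a, 'v, 'w) extension \<Rightarrow> 'w \<Rightarrow> 'w \<Rightarrow> 'w set" where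
  "hat U M a = {x \<in> carrier (internal_alg U M). approx U M x a}"

definition nonstandard_hull :: "('a, 'v, 'w) extension \<Rightarrow> 'w \<Rightarrow> (complex, real, 'w set) cstar" where
  "nonstandard_hull U M = \<lparr>
    carrier = hat U M ` Fin U M,
    mult = (\<lambda>X Y. THE Z. \<exists>a\<in>Fin U M. \<exists>b\<in>Fin U M.
      X = hat U M a \<and> Y = hat U M b \<and> Z = hat U M (a \<otimes>\<^bsub>internal_alg U M\<^esub> b)),
    one = hat U M (\<one>\<^bsub>internal_alg U M\<^esub>),
    zero = hat U M (\<zero>\<^bsub>internal_alg U M\<^esub>),
    add = (\<lambda>X Y. THE Z. \<exists>a\<in>Fin U M. \<exists>b\<in>Fin U M.
      X = hat U M a \<and> Y = hat U M b \<and> Z = hat U M (a \<oplus>\<^bsub>internal_alg U M\<^esub> b)),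
    smult = (\<lambda>c X. THE Z. \<exists>a\<in>Fin U M.
      X = hat U M a \<and> Z = hat U M (star U (emb_num U c) \<odot>\<^bsub>internal_alg U M\<^esub> a)),
    adj = (\<lambda>X. THE Z. \<exists>a\<in>Fin U M. X = hat U M a \<and> Z = hat U M (adj (internal_alg U M) a)),
    alg_norm = (\<lambda>X. THE r. \<exists>a\<in>Fin U M.
      X = hat U M a \<and> r = standard_part U (alg_norm (internal_alg U M) a))\<rparr>"

end

theory Submission
  imports Defs "HOL-Computational_Algebra.Polynomial"
begin

text \<open>
  In an ordinary \<open>C\<^sup>*\<close>-algebra, if \<open>a = v\<^sup>* v\<close> satisfies \<open>\<parallel>a\<^sup>2 - a\<parallel> \<le> 1/1000\<close>, there is a partial isometry
  \<open>u\<close> with \<open>\<parallel>u - v\<parallel> \<le> 8 \<parallel>a\<^sup>2 - a\<parallel>\<^sup>1\<^sup>/\<^sup>2\<close>. No functional calculus is needed: \<open>u\<close> is the limit of the Newton-like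
  iteration \<open>v \<mapsto> v p(v\<^sup>* v)\<close> for a quadratic polynomial \<open>p\<close>, which drives the spectrum of \<open>v\<^sup>* v\<close> to \<open>{0, 1}\<close>.
  By transfer the same holds in an internal algebra. If \<open>v\<close> is a partial isometry in the hull, then
  \<open>\<parallel>a\<^sup>2 - a\<parallel>\<close> is infinitesimal, hence so is \<open>\<parallel>u - v\<parallel>\<close>. Applied to a lift of a projection this gives the
  projection \<open>u\<^sup>* u\<close>; applied to a lift of a partial isometry that implements an equivalence, the
  projections \<open>u\<^sup>* u\<close> and \<open>u u\<^sup>*\<close>.
\<close>

section \<open>Approximate partial isometries\<close>

context cstar_algebra
begin

section \<open>Scalars, adjoints and norm estimates\<close>

lemma smult_carrier [simp, intro]: "x \<in> carrier A \<Longrightarrow> c \<odot> x \<in> carrier A"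
  using scalars.smult_closed[of c x] by (simp add: complex_ring_def)

lemma smult_add_left: "x \<in> carrier A \<Longrightarrow> (b + c) \<odot> x = b \<odot> x \<oplus> c \<odot> x"
  using scalars.smult_l_distr[of b c x] by (simp add: complex_ring_def)

lemma smult_add_right:
  "\<lbrakk>x \<in> carrier A; y \<in> carrier A\<rbrakk> \<Longrightarrow> c \<odot> (x \<oplus> y) = c \<odot> x \<oplus> c \<odot> y"
  using scalars.smult_r_distr[of c x y] by (simp add: complex_ring_def)

lemma smult_smult: "x \<in> carrier A \<Longrightarrow> b \<odot> (c \<odot> x) = (b * c) \<odot> x"
  using scalars.smult_assoc1[of b c x] by (simp add: complex_ring_def)

lemma smult_1 [simp]: "x \<in> carrier A \<Longrightarrow> 1 \<odot> x = x"
  using scalars.smult_one[of x] by (simp add: complex_ring_def)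

lemma norm_0 [simp]: "alg_norm A \<zero> = 0"
  using norm_eq_zero by simp

lemma smult_0_left [simp]: "x \<in> carrier A \<Longrightarrow> 0 \<odot> x = \<zero>"
  using norm_smult[of x 0] norm_eq_zero[of "0 \<odot> x"] by simp

lemma smult_0_right [simp]: "c \<odot> \<zero> = \<zero>"
  using norm_smult[of \<zero> c] norm_eq_zero[of "c \<odot> \<zero>"] by simp

lemma smult_minus_1: "x \<in> carrier A \<Longrightarrow> (- 1) \<odot> x = \<ominus> x"
proof -
  assume x: "x \<in> carrier A"
  have "(- 1) \<odot> x \<oplus> x = \<zero>"
    using smult_add_left[of x "-1" 1] x by simp
  then show ?thesis using x minus_equality[of "(- 1) \<odot> x" x] by simp
qed

declare adj_closed [simp, intro] adj_adj [simp]

lemma adj_uminus: "x \<in> carrier A \<Longrightarrow> adj A (\<ominus> x) = \<ominus> adj A x"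
  using adj_smult[of x "-1"] by (simp add: smult_minus_1)

lemma adj_minus: "\<lbrakk>x \<in> carrier A; y \<in> carrier A\<rbrakk> \<Longrightarrow> adj A (x \<ominus> y) = adj A x \<ominus> adj A y"
  by (simp add: minus_eq adj_add adj_uminus)

lemma adj_one [simp]: "adj A \<one> = \<one>"
  using adj_mult[of "adj A \<one>" \<one>] by simp

lemma norm_uminus: "x \<in> carrier A \<Longrightarrow> alg_norm A (\<ominus> x) = alg_norm A x"
  using norm_smult[of x "-1"] by (simp add: smult_minus_1)

lemma norm_minus_commute:
  "\<lbrakk>x \<in> carrier A; y \<in> carrier A\<rbrakk> \<Longrightarrow> alg_norm A (x \<ominus> y) = alg_norm A (y \<ominus> x)"
  using norm_uminus[of "x \<ominus> y"] by (simp add: minus_eq minus_add a_comm)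

lemma norm_minus_triangle:
  assumes "x \<in> carrier A" "y \<in> carrier A" "z \<in> carrier A"
  shows "alg_norm A (x \<ominus> z) \<le> alg_norm A (x \<ominus> y) + alg_norm A (y \<ominus> z)"
proof -
  have "x \<ominus> z = (x \<ominus> y) \<oplus> (y \<ominus> z)"
    using assms by algebra
  then show ?thesis using norm_triangle[of "x \<ominus> y" "y \<ominus> z"] assms by simp
qed

lemma norm_le_add_minus:
  assumes "x \<in> carrier A" "y \<in> carrier A"
  shows "alg_norm A x \<le> alg_norm A (x \<ominus> y) + alg_norm A y"
proof -
  have "x = (x \<ominus> y) \<oplus> y"
    using assms by algebra
  then show ?thesis using norm_triangle[of "x \<ominus> y" y] assms by simp
qed

text \<open>By the C*-identity the squared norm of \<open>x\<close> is the norm of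
  \<open>x* x\<close>, hence at most the product of the norms of \<open>x*\<close> and
  \<open>x\<close>; a nonzero factor cancels. Used for \<open>x\<close> and for \<open>x*\<close>,
  this makes the involution isometric.\<close>

lemma norm_le_norm_adj: "x \<in> carrier A \<Longrightarrow> alg_norm A x \<le> alg_norm A (adj A x)"
proof -
  assume x: "x \<in> carrier A"
  have "(alg_norm A x)\<^sup>2 \<le> alg_norm A (adj A x) * alg_norm A x"
    using norm_mult[of "adj A x" x] cstar_identity[of x] x by simp
  then show ?thesis
    using norm_nonneg[OF x] norm_nonneg[OF adj_closed[OF x]]
    by (cases "alg_norm A x = 0") (auto simp: power2_eq_square)
qed

lemma norm_adj [simp]: "x \<in> carrier A \<Longrightarrow> alg_norm A (adj A x) = alg_norm A x"
  using norm_le_norm_adj[of x] norm_le_norm_adj[of "adj A x"] by simp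

text \<open>The C*-identity makes the norm of the unit equal to its own square, so it is 0 or 1. The
  value 0 occurs in the zero algebra, hence an inequality.\<close>

lemma norm_one_le: "alg_norm A \<one> \<le> 1"
  using cstar_identity[of \<one>] by (auto simp: power2_eq_square)

lemma minus_eq_zero_iff: "\<lbrakk>x \<in> carrier A; y \<in> carrier A\<rbrakk> \<Longrightarrow> x \<ominus> y = \<zero> \<longleftrightarrow> x = y"
  by (metis add.inv_closed add.inv_comm minus_eq minus_equality minus_minus r_neg)

lemma norm_minus_self [simp]: "x \<in> carrier A \<Longrightarrow> alg_norm A (x \<ominus> x) = 0"
  using minus_eq_zero_iff[of x x] by simp

lemma mult_minus_mult:
  assumes "x \<in> carrier A" "y \<in> carrier A" "x' \<in> carrier A" "y' \<in> carrier A"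
  shows "x \<otimes> y \<ominus> x' \<otimes> y' = x \<otimes> (y \<ominus> y') \<oplus> (x \<ominus> x') \<otimes> y'"
  using assms by algebra

lemma norm_mult_minus_mult:
  assumes "x \<in> carrier A" "y \<in> carrier A" "x' \<in> carrier A" "y' \<in> carrier A"
  shows "alg_norm A (x \<otimes> y \<ominus> x' \<otimes> y') \<le>
    alg_norm A x * alg_norm A (y \<ominus> y') + alg_norm A (x \<ominus> x') * alg_norm A y'"
  using norm_triangle[of "x \<otimes> (y \<ominus> y')" "(x \<ominus> x') \<otimes> y'"]
    norm_mult[of x "y \<ominus> y'"] norm_mult[of "x \<ominus> x'" y'] assms
  by (simp add: mult_minus_mult)

section \<open>Real polynomials evaluated at an element\<close>

text \<open>Horner's scheme. Real coefficients keep the values at a self-adjoint element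
  self-adjoint, and relations between values at one element become identities in
  \<open>real poly\<close>.\<close>

definition pev :: "'a \<Rightarrow> real poly \<Rightarrow> 'a" where
  "pev a p = fold_coeffs (\<lambda>c s. (complex_of_real c \<odot> \<one>) \<oplus> (a \<otimes> s)) p \<zero>"

lemma pev_0 [simp]: "pev a 0 = \<zero>"
  by (simp add: pev_def)

lemma pev_pCons: 
  assumes "a \<in> carrier A"
  shows "pev a (pCons c p) = (complex_of_real c \<odot> \<one>) \<oplus> (a \<otimes> pev a p)"
  \<comment> \<open>\<open>fold_coeffs\<close> drops a vanishing leading coefficient, so
    \<open>pCons 0 0\<close> is a case of its own: both sides are then zero.\<close>
  using assms by (cases "c = 0 \<and> p = 0") (auto simp: pev_def fold_coeffs_def cCons_def)

lemma pev_closed [simp, intro]: "a \<in> carrier A \<Longrightarrow> pev a p \<in> carrier A"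
  by (induct p) (auto simp: pev_pCons)

lemma pev_add: 
  assumes a: "a \<in> carrier A"
  shows "pev a (p + q) = pev a p \<oplus> pev a q"
proof (induct p arbitrary: q)
  case (pCons c p)
  obtain d q' where q: "q = pCons d q'" by (cases q)
  show ?case using a
    by (simp add: q pCons pev_pCons smult_add_left r_distr a_ac)
qed (use a in auto)

lemma pev_smult: "a \<in> carrier A \<Longrightarrow> pev a (Polynomial.smult c p) = complex_of_real c \<odot> pev a p"
  by (induct p) (simp_all add: pev_pCons smult_add_right smult_smult smult_mult_right)

text \<open>Noncommutativity of the algebra does no harm: Horner's scheme multiplies by
  \<open>a\<close> from the left only and scalars pass through products, so associativity and
  distributivity suffice.\<close>

lemma pev_mult: "a \<in> carrier A \<Longrightarrow> pev a (p * q) = pev a p \<otimes> pev a q"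
proof (induct p)
  case (pCons c p)
  then show ?case
    by (simp add: pev_add pev_smult pev_pCons l_distr m_assoc
        flip: smult_mult_left[of \<one>])
qed simp

lemma pev_diff: 
  assumes a: "a \<in> carrier A"
  shows "pev a (p - q) = pev a p \<ominus> pev a q"
proof -
  have "p - q = p + Polynomial.smult (- 1) q" by simp
  then show ?thesis
    using a by (simp only: pev_add pev_smult) (simp add: smult_minus_1 minus_eq)
qed

lemma pev_1 [simp]: "a \<in> carrier A \<Longrightarrow> pev a 1 = \<one>"
  by (simp add: one_pCons pev_pCons)

lemma pev_X [simp]: "a \<in> carrier A \<Longrightarrow> pev a [:0, 1:] = a"
  by (simp add: pev_pCons)

text \<open>The adjoint reverses \<open>a \<otimes> pev a p\<close>; commutativity of polynomial
  multiplication restores the order.\<close>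

lemma pev_adj:
  assumes a: "a \<in> carrier A" "adj A a = a"
  shows "adj A (pev a p) = pev a p"
proof (induct p)
  case 0
  show ?case using adj_smult[of \<zero> 0] by simp
next
  case (pCons c p)
  have "pev a p \<otimes> a = a \<otimes> pev a p"
    using a pev_mult[of a p "[:0,1:]"] pev_mult[of a "[:0,1:]" p] by (simp add: mult.commute)
  then show ?case using a pCons by (simp add: pev_pCons adj_add adj_mult adj_smult)
qed

text \<open>The triangle inequality along Horner's scheme. This crude bound by absolute coefficients
  takes the place of a supremum over the spectrum.\<close>

lemma norm_pev_le:
  assumes a: "a \<in> carrier A" and B: "alg_norm A a \<le> B"
  shows "alg_norm A (pev a p) \<le> poly (map_poly abs p) B"
proof (induct p)
  case (pCons c p)
  have B0: "0 \<le> B" using B norm_nonneg[OF a] by linarith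
  have "alg_norm A (pev a (pCons c p)) \<le>
      alg_norm A (complex_of_real c \<odot> \<one>) + alg_norm A (a \<otimes> pev a p)"
    using a by (simp add: pev_pCons norm_triangle)
  also have "alg_norm A (complex_of_real c \<odot> \<one>) \<le> \<bar>c\<bar>"
    using norm_one_le by (simp add: norm_smult mult_left_le)
  also have "alg_norm A (a \<otimes> pev a p) \<le> alg_norm A a * alg_norm A (pev a p)"
    using a by (simp add: norm_mult)
  also have "\<dots> \<le> B * poly (map_poly abs p) B"
    by (rule mult_mono) (use B B0 a pCons norm_nonneg in auto)
  finally show ?case by (simp add: map_poly_pCons)
qed simp

section \<open>The defect of an element and the effect of one step\<close>

text \<open>Measures the failure of \<open>v* v\<close> to be idempotent. As \<open>v* v\<close> is
  self-adjoint, the defect vanishes exactly at the partial isometries.\<close>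

definition defect :: "'a \<Rightarrow> real" where
  "defect v = alg_norm A ((adj A v \<otimes> v) \<otimes> (adj A v \<otimes> v) \<ominus> adj A v \<otimes> v)"

text \<open>The polynomial \<open>p(t) = (5 t - 3 t\<^sup>2) / 2\<close> is determined by \<open>p(0) = 0\<close>, \<open>p(1) = 1\<close> and
  \<open>p'(1) = - 1 / 2\<close>, which make \<open>0\<close> and \<open>1\<close> superattracting fixed points of \<open>t p(t)\<^sup>2\<close>.\<close>

definition polar_step :: "'a \<Rightarrow> 'a" where
  "polar_step v = v \<otimes> pev (adj A v \<otimes> v) [:0, 5/2, -3/2:]"

lemma defect_nonneg: "v \<in> carrier A \<Longrightarrow> 0 \<le> defect v"
  by (simp add: defect_def norm_nonneg)

lemma adj_mult_self: "v \<in> carrier A \<Longrightarrow> adj A (adj A v \<otimes> v) = adj A v \<otimes> v"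
  by (simp add: adj_mult)

lemma polar_step_closed [simp, intro]: "v \<in> carrier A \<Longrightarrow> polar_step v \<in> carrier A"
  by (simp add: polar_step_def)

lemma defect_pev:
  "v \<in> carrier A \<Longrightarrow> defect v = alg_norm A (pev (adj A v \<otimes> v) [:0, -1, 1:])"
proof -
  assume v: "v \<in> carrier A"
  let ?a = "adj A v \<otimes> v"
  have "[:0, -1, 1::real:] = [:0, 1:] * [:0, 1:] - [:0, 1:]" by simp
  then have "pev ?a [:0, -1, 1:] = ?a \<otimes> ?a \<ominus> ?a"
    using v by (simp only: pev_diff pev_mult pev_X m_closed adj_closed)
  then show ?thesis by (simp add: defect_def)
qed

text \<open>Let r be the norm of \<open>a = v* v\<close>. Since \<open>a\<close> is self-adjoint,
  the C*-identity gives r^2 as the norm of a^2, so r^2 \<le> d + r. But r > 1 + d would give r (r -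
  1) > (1 + d) d \<ge> d.\<close>

lemma norm_adj_mult_self_le:
  assumes v: "v \<in> carrier A" and "defect v \<le> d" "0 \<le> d"
  shows "alg_norm A (adj A v \<otimes> v) \<le> 1 + d"
proof (rule ccontr)
  let ?a = "adj A v \<otimes> v"
  let ?r = "alg_norm A ?a"
  assume "\<not> ?r \<le> 1 + d"
  then have r: "1 + d < ?r" by simp
  have "?r\<^sup>2 = alg_norm A (?a \<otimes> ?a)"
    using cstar_identity[of ?a] v by (simp add: adj_mult_self)
  also have "\<dots> \<le> d + ?r"
    using norm_le_add_minus[of "?a \<otimes> ?a" ?a] v assms(2) by (simp add: defect_def)
  finally have "?r * (?r - 1) \<le> d" by (simp add: power2_eq_square algebra_simps)
  moreover have "(1 + d) * d < ?r * (?r - 1)"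
    using r assms(3) by (intro mult_strict_mono) auto
  ultimately show False using assms(3) by (simp add: algebra_simps)
      (smt (verit) zero_le_square)
qed

text \<open>Replacing \<open>v\<close> by \<open>v p(a)\<close> with \<open>a = v* v\<close>
  replaces \<open>a\<close> by \<open>p(a) a p(a)\<close>, again a polynomial in \<open>a\<close>.
  Thus the effect of a step is a question about polynomials in one variable.\<close>

lemma pev_conjugate:
  assumes v: "v \<in> carrier A"
  shows "adj A (v \<otimes> pev (adj A v \<otimes> v) p) \<otimes> (v \<otimes> pev (adj A v \<otimes> v) p) =
    pev (adj A v \<otimes> v) (p * [:0, 1:] * p)"
proof -
  let ?a = "adj A v \<otimes> v"
  have a: "?a \<in> carrier A" "adj A ?a = ?a" using v by (simp_all add: adj_mult_self)
  have "adj A (v \<otimes> pev ?a p) \<otimes> (v \<otimes> pev ?a p) = (pev ?a p \<otimes> ?a) \<otimes> pev ?a p"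
    using v a by (simp add: adj_mult pev_adj m_assoc)
  also have "\<dots> = pev ?a (p * [:0, 1:] * p)"
    using a by (simp only: pev_mult pev_X)
  finally show ?thesis .
qed

text \<open>With \<open>g(t) = t p(t)\<^sup>2\<close> the step turns \<open>v\<^sup>* v\<close> into \<open>g(v\<^sup>* v)\<close>, and \<open>(t\<^sup>2 - t)\<^sup>2\<close> divides \<open>g(t)\<^sup>2 - g(t)\<close>:
  the convergence is quadratic.\<close>

lemma defect_polar_step:
  assumes v: "v \<in> carrier A" and d: "defect v \<le> 1 / 1000"
  shows "defect (polar_step v) \<le> defect v / 4"
proof -
  let ?a = "adj A v \<otimes> v"
  let ?g = "[:0, 5/2, -3/2:] * [:0, 1:] * [:0, 5/2, -3/2:] :: real poly"
  let ?d = "[:0, -1, 1:] :: real poly"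
  \<comment> \<open>The quotient of g^2 - g by (t^2 - t)^2. It exists because g has a triple zero at
    0 and g - 1 a double zero at 1; the surplus factor t stays in \<open>q\<close>.\<close>
  define q :: "real poly" where
    "q = Polynomial.smult (- 1 / 16) ([:0, 1:] * [:5, -3:] * [:5, -3:] * [:4, 8, 12, -9:])"
  have a: "?a \<in> carrier A" using v by simp
  have B: "alg_norm A ?a \<le> 1001 / 1000"
    using norm_adj_mult_self_le[OF v d] by simp
  have g: "adj A (polar_step v) \<otimes> polar_step v = pev ?a ?g"
    using v unfolding polar_step_def by (rule pev_conjugate)
  have "pev ?a ?g \<otimes> pev ?a ?g \<ominus> pev ?a ?g = pev ?a (?g * ?g - ?g)"
    using a by (simp only: pev_diff pev_mult)
  also have "?g * ?g - ?g = ?d * ?d * q"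
    by (simp add: q_def)
  finally have "defect (polar_step v) = alg_norm A (pev ?a ?d \<otimes> pev ?a ?d \<otimes> pev ?a q)"
    using a by (simp only: defect_def g pev_mult)
  also have "\<dots> \<le> alg_norm A (pev ?a ?d \<otimes> pev ?a ?d) * alg_norm A (pev ?a q)"
    using a by (simp add: norm_mult)
  \<comment> \<open>A generous coefficient bound for \<open>q\<close> on norms up to 1001/1000. It
    is chosen so that one of the two factors \<open>defect v \<le> 1 / 1000\<close> turns it into
    1/4.\<close>
  also have "\<dots> \<le> (defect v * defect v) * 250"
  proof (rule mult_mono)
    show "alg_norm A (pev ?a ?d \<otimes> pev ?a ?d) \<le> defect v * defect v"
      using norm_mult[of "pev ?a ?d" "pev ?a ?d"] a by (simp add: defect_pev v)
    have "alg_norm A (pev ?a q) \<le> poly (map_poly abs q) (1001 / 1000)"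
      using a B by (rule norm_pev_le)
    also have "\<dots> \<le> 250"
      by (simp add: q_def map_poly_pCons)
    finally show "alg_norm A (pev ?a q) \<le> 250" .
  qed (use a in \<open>auto simp: norm_nonneg\<close>)
  also have "\<dots> = defect v * (defect v * 250)" by simp
  also have "\<dots> \<le> defect v * (1 / 4)"
    using d defect_nonneg[OF v] by (intro mult_left_mono) auto
  finally show ?thesis by simp
qed

text \<open>By the C*-identity the squared norm is that of t (p(t) - 1)^2 evaluated at
  \<open>v* v\<close>. The zero of this polynomial at 0 is only simple, so only one factor t^2 - t
  splits off, and the bound involves the square root of the defect.\<close>

lemma norm_polar_step_minus:
  assumes v: "v \<in> carrier A" and d: "defect v \<le> 1 / 1000"
  shows "alg_norm A (polar_step v \<ominus> v) \<le> 4 * sqrt (defect v)"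
proof -
  let ?a = "adj A v \<otimes> v"
  let ?p = "[:0, 5/2, -3/2:] :: real poly"
  let ?d = "[:0, -1, 1:] :: real poly"
  define s :: "real poly" where "s = [:-1, 1:] * [:1, -3/2:] * [:1, -3/2:]"
  have a: "?a \<in> carrier A" using v by simp
  have B: "alg_norm A ?a \<le> 1001 / 1000"
    using norm_adj_mult_self_le[OF v d] by simp
  have "polar_step v \<ominus> v = v \<otimes> pev ?a (?p - 1)"
  proof -
    have "v \<otimes> pev ?a (?p - 1) = v \<otimes> (pev ?a ?p \<ominus> \<one>)"
      using a by (simp only: pev_diff pev_1)
    also have "\<dots> = polar_step v \<ominus> v"
      using v unfolding polar_step_def by (simp add: minus_eq r_distr r_minus)
    finally show ?thesis by simp
  qed
  then have "(alg_norm A (polar_step v \<ominus> v))\<^sup>2 =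
      alg_norm A (pev ?a ((?p - 1) * [:0, 1:] * (?p - 1)))"
    using cstar_identity[of "v \<otimes> pev ?a (?p - 1)"] pev_conjugate[OF v, of "?p - 1"] v
    by (simp del: mult_pCons_left mult_pCons_right)
  also have "(?p - 1) * [:0, 1:] * (?p - 1) = ?d * s"
    by (simp add: s_def one_pCons)
  also have "alg_norm A (pev ?a (?d * s)) \<le> alg_norm A (pev ?a ?d) * alg_norm A (pev ?a s)"
    using a by (simp only: pev_mult norm_mult pev_closed)
  \<comment> \<open>16 bounds the cofactor \<open>s\<close> on norms up to 1001/1000; its square
    root is the 4 of the claim.\<close>
  also have "\<dots> \<le> defect v * 16"
  proof (rule mult_mono)
    have "alg_norm A (pev ?a s) \<le> poly (map_poly abs s) (1001 / 1000)"
      using a B by (rule norm_pev_le)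
    also have "\<dots> \<le> 16"
      by (simp add: s_def map_poly_pCons)
    finally show "alg_norm A (pev ?a s) \<le> 16" .
  qed (use a in \<open>auto simp: norm_nonneg defect_pev v\<close>)
  finally have "alg_norm A (polar_step v \<ominus> v) \<le> sqrt (defect v * 16)"
    by (rule real_le_rsqrt)
  then show ?thesis by (simp add: real_sqrt_mult)
qed

section \<open>The iteration and its limit\<close>

definition polar_iter :: "'a \<Rightarrow> nat \<Rightarrow> 'a" where
  "polar_iter v n = (polar_step ^^ n) v"

lemma polar_iter_closed [simp, intro]: "v \<in> carrier A \<Longrightarrow> polar_iter v n \<in> carrier A"
  by (induct n) (auto simp: polar_iter_def)

lemma defect_polar_iter:
  assumes v: "v \<in> carrier A" and d: "defect v \<le> 1 / 1000"
  shows "defect (polar_iter v n) \<le> defect v / 4 ^ n"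
proof (induct n)
  case (Suc n)
  have "defect v / 4 ^ n \<le> defect v"
    using defect_nonneg[OF v] by (simp add: divide_le_eq mult_le_cancel_left1)
  then have "defect (polar_iter v n) \<le> 1 / 1000" using Suc d by linarith
  from defect_polar_step[OF polar_iter_closed[OF v] this] Suc show ?case
    by (simp add: polar_iter_def)
qed (simp add: polar_iter_def)

lemma defect_polar_iter_le:
  assumes v: "v \<in> carrier A" and d: "defect v \<le> 1 / 1000"
  shows "defect (polar_iter v n) \<le> 1 / 1000"
proof -
  have "defect v / 4 ^ n \<le> defect v"
    using defect_nonneg[OF v] by (simp add: divide_le_eq mult_le_cancel_left1)
  then show ?thesis using defect_polar_iter[OF assms, of n] d by linarith
qed

text \<open>The defect shrinks by 1/4 per step, and the length of a step is controlled by its square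
  root, so the bound on the step length is halved each time.\<close>

lemma norm_polar_iter_minus_Suc:
  assumes v: "v \<in> carrier A" and d: "defect v \<le> 1 / 1000"
  shows "alg_norm A (polar_iter v (Suc n) \<ominus> polar_iter v n) \<le> 4 * sqrt (defect v) / 2 ^ n"
proof -
  have dn: "defect (polar_iter v n) \<le> defect v / 4 ^ n"
    by (rule defect_polar_iter[OF assms])
  from norm_polar_step_minus[OF polar_iter_closed[OF v] defect_polar_iter_le[OF assms]]
  have "alg_norm A (polar_iter v (Suc n) \<ominus> polar_iter v n) \<le> 4 * sqrt (defect (polar_iter v n))"
    by (simp add: polar_iter_def)
  also have "sqrt (defect (polar_iter v n)) \<le> sqrt (defect v / (2 ^ n)\<^sup>2)"
    using dn by (simp add: power2_eq_square flip: power_mult_distrib)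
  also have "\<dots> = sqrt (defect v) / 2 ^ n"
    by (simp add: real_sqrt_divide)
  finally show ?thesis by simp
qed

text \<open>Summing the geometric series of step lengths. Large \<open>n\<close> gives the Cauchy
  property, and \<open>n = 0\<close> gives the distance from the starting point.\<close>

lemma norm_polar_iter_minus:
  assumes v: "v \<in> carrier A" and d: "defect v \<le> 1 / 1000"
  shows "alg_norm A (polar_iter v (n + k) \<ominus> polar_iter v n) \<le> 8 * sqrt (defect v) / 2 ^ n"
proof -
  let ?s = "sqrt (defect v)"
  \<comment> \<open>The exact partial sum of the geometric series, kept in this form so that the
    induction on \<open>k\<close> closes.\<close>
  have "alg_norm A (polar_iter v (n + k) \<ominus> polar_iter v n) \<le> 8 * ?s / 2 ^ n - 8 * ?s / 2 ^ (n + k)"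
  proof (induct k)
    case 0
    then show ?case using v minus_eq_zero_iff[of "polar_iter v n" "polar_iter v n"] by simp
  next
    case (Suc k)
    have "alg_norm A (polar_iter v (n + Suc k) \<ominus> polar_iter v n) \<le>
        alg_norm A (polar_iter v (Suc (n + k)) \<ominus> polar_iter v (n + k)) +
        alg_norm A (polar_iter v (n + k) \<ominus> polar_iter v n)"
      using v norm_minus_triangle by simp
    also have "\<dots> \<le> 4 * ?s / 2 ^ (n + k) + (8 * ?s / 2 ^ n - 8 * ?s / 2 ^ (n + k))"
      using norm_polar_iter_minus_Suc[OF assms, of "n + k"] Suc by (rule add_mono)
    also have "\<dots> = 8 * ?s / 2 ^ n - 8 * ?s / 2 ^ (n + Suc k)"
      by simp
    finally show ?case .
  qed
  also have "\<dots> \<le> 8 * ?s / 2 ^ n"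
    using defect_nonneg[OF v] by simp
  finally show ?thesis .
qed

text \<open>A Lipschitz estimate on the ball of radius 2, used to pass the defect to the limit. With
  e the distance of \<open>u\<close> and \<open>v\<close>, the elements \<open>u* u\<close> and
  \<open>v* v\<close> differ by at most 4 e and their squares by at most 32 e, which add up to 36
  e.\<close>

lemma defect_le:
  assumes "u \<in> carrier A" "v \<in> carrier A" "alg_norm A u \<le> 2" "alg_norm A v \<le> 2"
  shows "defect u \<le> defect v + 36 * alg_norm A (u \<ominus> v)"
proof -
  let ?a = "adj A u \<otimes> u" and ?b = "adj A v \<otimes> v" and ?e = "alg_norm A (u \<ominus> v)"
  have e: "0 \<le> ?e" using assms by (simp add: norm_nonneg)
  have ab: "?a \<in> carrier A" "?b \<in> carrier A" using assms by auto
  have 1: "alg_norm A (?a \<ominus> ?b) \<le> 4 * ?e"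
  proof -
    have "alg_norm A (?a \<ominus> ?b) \<le> alg_norm A u * ?e + alg_norm A (adj A u \<ominus> adj A v) * alg_norm A v"
      using norm_mult_minus_mult[of "adj A u" u "adj A v" v] assms by simp
    also have "alg_norm A (adj A u \<ominus> adj A v) = ?e"
      using norm_adj[of "u \<ominus> v"] assms by (simp add: adj_minus)
    also have "alg_norm A u * ?e + ?e * alg_norm A v \<le> 2 * ?e + ?e * 2"
      using assms e by (intro add_mono mult_left_mono mult_right_mono)
    finally show ?thesis by simp
  qed
  have sq: "(alg_norm A w)\<^sup>2 \<le> 4" if "w \<in> carrier A" "alg_norm A w \<le> 2" for w
    using power_mono[OF that(2) norm_nonneg[OF that(1)], of 2] by simp
  have n: "alg_norm A ?a \<le> 4" "alg_norm A ?b \<le> 4"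
    using assms by (simp_all add: cstar_identity sq)
  have 2: "alg_norm A (?a \<otimes> ?a \<ominus> ?b \<otimes> ?b) \<le> 4 * (4 * ?e) + (4 * ?e) * 4"
  proof -
    have "alg_norm A (?a \<otimes> ?a \<ominus> ?b \<otimes> ?b) \<le>
        alg_norm A ?a * alg_norm A (?a \<ominus> ?b) + alg_norm A (?a \<ominus> ?b) * alg_norm A ?b"
      by (rule norm_mult_minus_mult[OF ab(1) ab(1) ab(2) ab(2)])
    also have "\<dots> \<le> 4 * (4 * ?e) + (4 * ?e) * 4"
      using 1 n ab e by (intro add_mono mult_mono) (auto simp: norm_nonneg)
    finally show ?thesis .
  qed
  have "?a \<otimes> ?a \<ominus> ?a = ((?a \<otimes> ?a \<ominus> ?b \<otimes> ?b) \<oplus> (?b \<ominus> ?a)) \<oplus> (?b \<otimes> ?b \<ominus> ?b)"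
    using ab by algebra
  then have "defect u \<le> alg_norm A ((?a \<otimes> ?a \<ominus> ?b \<otimes> ?b) \<oplus> (?b \<ominus> ?a)) + defect v"
    using ab by (simp add: defect_def norm_triangle)
  also have "alg_norm A ((?a \<otimes> ?a \<ominus> ?b \<otimes> ?b) \<oplus> (?b \<ominus> ?a)) \<le>
      alg_norm A (?a \<otimes> ?a \<ominus> ?b \<otimes> ?b) + alg_norm A (?b \<ominus> ?a)"
    using ab by (simp add: norm_triangle)
  finally show ?thesis
    using 1 2 norm_minus_commute[OF ab] by linarith
qed

lemma defect_eq_0_iff: "v \<in> carrier A \<Longrightarrow> defect v = 0 \<longleftrightarrow> partial_isometry A v"
  by (auto simp: defect_def partial_isometry_def projection_def adj_mult_self norm_eq_zero
      minus_eq_zero_iff)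

lemma norm_le_if_defect_le:
  assumes v: "v \<in> carrier A" and d: "defect v \<le> 1"
  shows "alg_norm A v \<le> 2"
proof -
  have "(alg_norm A v)\<^sup>2 \<le> 2\<^sup>2"
    using norm_adj_mult_self_le[OF v d] v by (simp add: cstar_identity)
  then show ?thesis by (rule power2_le_imp_le) simp
qed

text \<open>The iterates form a Cauchy sequence, so completeness yields a limit \<open>u\<close>.
  Their defects tend to 0 and the defect is Lipschitz on bounded sets, so \<open>u\<close> has
  defect 0; the distance bound from the start survives in the limit.\<close>

theorem partial_isometry_near:
  assumes v: "v \<in> carrier A" and d: "defect v \<le> 1 / 1000"
  shows "\<exists>u. partial_isometry A u \<and> alg_norm A (u \<ominus> v) \<le> 8 * sqrt (defect v)"
proof -
  let ?w = "polar_iter v" and ?s = "8 * sqrt (defect v)"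
  have s: "0 \<le> ?s" using defect_nonneg[OF v] by simp
  have small: "\<exists>N. \<forall>n\<ge>N. ?s / 2 ^ n < e" if "0 < e" for e
  proof -
    have "(\<lambda>n. ?s / 2 ^ n) \<longlonglongrightarrow> 0"
      by (rule LIMSEQ_divide_realpow_zero) simp
    from order_tendstoD(2)[OF this that] show ?thesis
      by (simp add: eventually_sequentially)
  qed
  have "\<exists>N. \<forall>m\<ge>N. \<forall>n\<ge>N. alg_norm A (?w m \<ominus> ?w n) < e" if e: "0 < e" for e
  proof -
    obtain N where N: "\<And>n. n \<ge> N \<Longrightarrow> ?s / 2 ^ n < e" using small[OF e] by blast
    have le: "alg_norm A (?w m \<ominus> ?w n) < e" if "m \<ge> N" "n \<ge> N" "n \<le> m" for m n
      using norm_polar_iter_minus[OF v d, of n "m - n"] N[OF that(2)] that(3) by simp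
    then have "alg_norm A (?w m \<ominus> ?w n) < e" if "m \<ge> N" "n \<ge> N" for m n
      using that le[of m n] le[of n m] norm_minus_commute[of "?w m" "?w n"] v
      by (cases "n \<le> m") auto
    then show ?thesis by blast
  qed
  then obtain u where u: "u \<in> carrier A" and lim: "(\<lambda>n. alg_norm A (?w n \<ominus> u)) \<longlonglongrightarrow> 0"
    using complete[of ?w] v by blast
  have dn: "defect (?w n) \<le> defect v / 4 ^ n" for n
    by (rule defect_polar_iter[OF v d])
  have w2: "alg_norm A (?w n) \<le> 2" for n
    using defect_polar_iter_le[OF v d, of n] v by (intro norm_le_if_defect_le) auto
  have comm: "alg_norm A (u \<ominus> ?w n) = alg_norm A (?w n \<ominus> u)" for n
    using u v by (simp add: norm_minus_commute)
  \<comment> \<open>The limit must lie in the ball on which \<open>defect_le\<close>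
    applies.\<close>
  have u2: "alg_norm A u \<le> 2"
  proof (rule LIMSEQ_le_const)
    show "(\<lambda>n. alg_norm A (?w n \<ominus> u) + 2) \<longlonglongrightarrow> 2"
      using tendsto_add[OF lim tendsto_const[of 2]] by simp
    have "alg_norm A u \<le> alg_norm A (?w n \<ominus> u) + 2" for n
      using norm_le_add_minus[OF u polar_iter_closed[OF v, of n]] w2[of n] comm[of n] by linarith
    then show "\<exists>N. \<forall>n\<ge>N. alg_norm A u \<le> alg_norm A (?w n \<ominus> u) + 2" by blast
  qed
  have "defect u \<le> 0"
  proof (rule LIMSEQ_le_const)
    have "(\<lambda>n. defect v / 4 ^ n) \<longlonglongrightarrow> 0"
      by (rule LIMSEQ_divide_realpow_zero) simp
    from tendsto_add[OF this tendsto_mult[OF tendsto_const[of 36] lim]]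
    show "(\<lambda>n. defect v / 4 ^ n + 36 * alg_norm A (?w n \<ominus> u)) \<longlonglongrightarrow> 0" by simp
    have "defect u \<le> defect v / 4 ^ n + 36 * alg_norm A (?w n \<ominus> u)" for n
      using defect_le[OF u polar_iter_closed[OF v] u2 w2, of n] dn[of n] comm[of n] by simp
    then show "\<exists>N. \<forall>n\<ge>N. defect u \<le> defect v / 4 ^ n + 36 * alg_norm A (?w n \<ominus> u)" by blast
  qed
  then have "partial_isometry A u"
    using defect_eq_0_iff[OF u] defect_nonneg[OF u] by simp
  moreover have "alg_norm A (u \<ominus> v) \<le> ?s"
  proof (rule LIMSEQ_le_const)
    show "(\<lambda>n. alg_norm A (?w n \<ominus> u) + ?s) \<longlonglongrightarrow> ?s"
      using tendsto_add[OF lim tendsto_const[of ?s]] by simp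
    have "alg_norm A (u \<ominus> v) \<le> alg_norm A (?w n \<ominus> u) + ?s" for n
      using norm_minus_triangle[OF u polar_iter_closed[OF v, of n] v] comm[of n]
        norm_polar_iter_minus[OF v d, of 0 n] by (simp add: polar_iter_def)
    then show "\<exists>N. \<forall>n\<ge>N. alg_norm A (u \<ominus> v) \<le> alg_norm A (?w n \<ominus> u) + ?s" by blast
  qed
  ultimately show ?thesis by blast
qed

section \<open>The final projection of a partial isometry\<close>

text \<open>Let \<open>p = u* u\<close> and \<open>d = u - u p\<close>. Expanding
  \<open>d* d\<close> gives an alternating sum of powers of \<open>p\<close>, which is 0 as
  \<open>p\<close> is idempotent. By the C*-identity \<open>d = 0\<close>, so
  \<open>u p = u\<close>, and \<open>u u*\<close> is idempotent.\<close>

lemma partial_isometry_mult_adj: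
  assumes "partial_isometry A u"
  shows "projection A (u \<otimes> adj A u)"
proof -
  let ?p = "adj A u \<otimes> u"
  have u: "u \<in> carrier A" and p: "?p \<otimes> ?p = ?p"
    using assms by (auto simp: partial_isometry_def projection_def)
  have pc: "?p \<in> carrier A" using u by simp
  let ?d = "u \<ominus> u \<otimes> ?p"
  have "adj A ?d = adj A u \<ominus> ?p \<otimes> adj A u"
    using u by (simp add: adj_minus adj_mult m_assoc)
  then have "adj A ?d \<otimes> ?d = (?p \<ominus> ?p \<otimes> ?p) \<ominus> (?p \<otimes> ?p \<ominus> ?p \<otimes> ?p \<otimes> ?p)"
    using u by (simp add: minus_eq l_distr r_distr l_minus r_minus m_assoc minus_add)
  also have "\<dots> = \<zero>" using pc by (simp add: p minus_eq r_neg)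
  finally have "?d = \<zero>"
    using cstar_identity[of ?d] norm_eq_zero[of ?d] u by simp
  then have "u \<otimes> ?p = u" using minus_eq_zero_iff[of u "u \<otimes> ?p"] u by simp
  then have "(u \<otimes> ?p) \<otimes> adj A u = u \<otimes> adj A u" by simp
  then show ?thesis using u by (simp add: projection_def adj_mult m_assoc)
qed

end

section \<open>Transfer\<close>

primrec fvars :: "'v fm \<Rightarrow> nat set" where
  "fvars (FRel R is) = set is"
| "fvars (FEq i j) = {i, j}"
| "fvars (FNot \<phi>) = fvars \<phi>"
| "fvars (FAnd \<phi> \<psi>) = fvars \<phi> \<union> fvars \<psi>"
| "fvars (FAll i \<phi>) = fvars \<phi> - {i}"

lemma finite_fvars [simp]: "finite (fvars \<phi>)"
  by (induct \<phi>) auto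

lemma sat_cong: "(\<And>i. i \<in> fvars \<phi> \<Longrightarrow> e i = e' i) \<Longrightarrow> sat I \<phi> e \<longleftrightarrow> sat I \<phi> e'"
proof (induct \<phi> arbitrary: e e')
  case (FRel R js)
  then have "map e js = map e' js" by simp
  then show ?case by (simp only: sat.simps)
next
  case (FAnd \<phi> \<psi>)
  have "sat I \<phi> e \<longleftrightarrow> sat I \<phi> e'"
    by (rule FAnd.hyps(1)) (simp add: FAnd.prems)
  moreover have "sat I \<psi> e \<longleftrightarrow> sat I \<psi> e'"
    by (rule FAnd.hyps(2)) (simp add: FAnd.prems)
  ultimately show ?case by simp
next
  case (FAll i \<phi>)
  have "sat I \<phi> (e(i := a)) \<longleftrightarrow> sat I \<phi> (e'(i := a))" for a
    by (rule FAll.hyps) (simp add: FAll.prems)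
  then show ?case by simp
next
  case (FNot \<phi>)
  have "sat I \<phi> e \<longleftrightarrow> sat I \<phi> e'"
    by (rule FNot.hyps) (simp add: FNot.prems)
  then show ?case by simp
qed simp

definition FImp :: "'v fm \<Rightarrow> 'v fm \<Rightarrow> 'v fm" where
  "FImp \<phi> \<psi> = FNot (FAnd \<phi> (FNot \<psi>))"

definition FIff :: "'v fm \<Rightarrow> 'v fm \<Rightarrow> 'v fm" where
  "FIff \<phi> \<psi> = FAnd (FImp \<phi> \<psi>) (FImp \<psi> \<phi>)"

definition FEx :: "nat \<Rightarrow> 'v fm \<Rightarrow> 'v fm" where
  "FEx i \<phi> = FNot (FAll i (FNot \<phi>))"

lemma sat_FImp [simp]: "sat I (FImp \<phi> \<psi>) e \<longleftrightarrow> (sat I \<phi> e \<longrightarrow> sat I \<psi> e)"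
  by (simp add: FImp_def)

lemma sat_FIff [simp]: "sat I (FIff \<phi> \<psi>) e \<longleftrightarrow> (sat I \<phi> e \<longleftrightarrow> sat I \<psi> e)"
  by (auto simp: FIff_def)

lemma sat_FEx [simp]: "sat I (FEx i \<phi>) e \<longleftrightarrow> (\<exists>a. sat I \<phi> (e(i := a)))"
  by (simp add: FEx_def)

text \<open>Describes the universal closure of a formula by all assignments that agree off the list,
  so that the order of the list and repetitions in it do not matter.\<close>

lemma sat_foldr_FAll:
  "sat I (foldr FAll is \<phi>) e \<longleftrightarrow> (\<forall>e'. (\<forall>i. i \<notin> set is \<longrightarrow> e' i = e i) \<longrightarrow> sat I \<phi> e')"
proof (induct "is" arbitrary: e)
  case Nil
  have "e' = e" if "\<forall>i. e' i = e i" for e' using that by auto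
  then show ?case by auto
next
  case (Cons j js)
  show ?case
  proof
    assume L: "sat I (foldr FAll (j # js) \<phi>) e"
    show "\<forall>e'. (\<forall>i. i \<notin> set (j # js) \<longrightarrow> e' i = e i) \<longrightarrow> sat I \<phi> e'"
    proof (intro allI impI)
      fix e' assume "\<forall>i. i \<notin> set (j # js) \<longrightarrow> e' i = e i"
      then have "\<forall>i. i \<notin> set js \<longrightarrow> e' i = (e(j := e' j)) i" by simp
      moreover have "sat I (foldr FAll js \<phi>) (e(j := e' j))" using L by simp
      ultimately show "sat I \<phi> e'" using Cons by blast
    qed
  next
    assume R: "\<forall>e'. (\<forall>i. i \<notin> set (j # js) \<longrightarrow> e' i = e i) \<longrightarrow> sat I \<phi> e'"
    have "sat I (foldr FAll js \<phi>) (e(j := a))" for a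
      using R by (auto simp: Cons)
    then show "sat I (foldr FAll (j # js) \<phi>) e" by simp
  qed
qed

section \<open>Transfer with internal parameters\<close>

locale universe =
  fixes U :: "('a, 'v, 'w) extension"
  assumes nonstandard: "nonstandard_universe U"
begin

lemma emb_eq_iff [simp]:
  "emb_point U x = emb_point U y \<longleftrightarrow> x = y"
  "emb_num U z = emb_num U w \<longleftrightarrow> z = w"
  "emb_alg U A = emb_alg U B \<longleftrightarrow> A = B"
  using nonstandard by (auto simp: nonstandard_universe_def inj_eq)

text \<open>The transfer principle concerns assignments of the form \<open>star U \<circ> e\<close>,
  whereas here the assignment is arbitrary. The universal closure of the formula is transferred and
  then instantiated; \<open>s\<close> only fills the variables that are not free.\<close>

lemma transfer:
  fixes \<phi> :: "'v fm"
  assumes "\<And>e. sat (\<lambda>R. R) \<phi> e"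
  shows "sat (star_rel U) \<phi> e"
proof -
  obtain "is" where "is": "set is = fvars \<phi>"
    using finite_list[OF finite_fvars] by blast
  fix s :: "nat \<Rightarrow> 'v"
  have "sat (\<lambda>R. R) (foldr FAll is \<phi>) s"
    using assms by (simp add: sat_foldr_FAll)
  then have "sat (star_rel U) (foldr FAll is \<phi>) (star U \<circ> s)"
    using nonstandard by (simp add: nonstandard_universe_def)
  then have "sat (star_rel U) \<phi> (\<lambda>i. if i \<in> set is then e i else (star U \<circ> s) i)"
    by (simp add: sat_foldr_FAll)
  then show ?thesis
    using sat_cong[of \<phi> "\<lambda>i. if i \<in> set is then e i else (star U \<circ> s) i" e "star_rel U"] "is"
    by simp
qed

text \<open>Standard constants enter formulas through singleton relations, since
  \<open>transfer\<close> quantifies over all assignments and fixes no parameter.\<close>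

lemma star_mem_singleton: "[star U c] \<in> star_rel U {[c]}"
proof -
  have "sat (\<lambda>R. R) (FRel {[c]} [0]) (\<lambda>_. c)" by simp
  then have "sat (star_rel U) (FRel {[c]} [0]) (star U \<circ> (\<lambda>_. c))"
    using nonstandard unfolding nonstandard_universe_def by blast
  then show ?thesis by simp
qed

text \<open>Functionality of a graph is a first-order statement, so the extended graph is functional
  too. This evaluates the definite descriptions by which the hyperreal and internal operations are
  defined.\<close>

lemma star_the_equality:
  assumes functional: "\<And>xs y z. xs @ [y] \<in> G \<Longrightarrow> xs @ [z] \<in> G \<Longrightarrow> y = z"
    and b: "as @ [b] \<in> star_rel U G"
  shows "(THE c. as @ [c] \<in> star_rel U G) = b"
proof (rule the_equality)
  fix c assume c: "as @ [c] \<in> star_rel U G"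
  let ?n = "length as"
  \<comment> \<open>The variables below \<open>?n\<close> hold the arguments; \<open>?n\<close> and
    \<open>Suc ?n\<close> hold two candidate values.\<close>
  have "sat (star_rel U) (FImp (FRel G ([0..<?n] @ [?n])) (FImp (FRel G ([0..<?n] @ [Suc ?n]))
      (FEq ?n (Suc ?n)))) ((!) (as @ [b, c]))"
    by (rule transfer) (auto dest: functional)
  moreover have "map ((!) (as @ [b, c])) [0..<?n] = as"
    by (rule nth_equalityI) (auto simp: nth_append)
  ultimately show "c = b" using b c by (simp add: nth_append)
qed (rule b)

text \<open>Every relation on the standard universe is a symbol, so any HOL predicate on algebra
  elements may serve as an atomic formula. Membership in a carrier of a genuine C*-algebra is built
  in, so that formulas need not state it.\<close>

definition rel1 :: "((complex, real, 'a) cstar \<Rightarrow> 'a \<Rightarrow> bool) \<Rightarrow> 'v list set" where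
  "rel1 P = {[emb_alg U A, emb_point U x] | A x. cstar_algebra A \<and> x \<in> carrier A \<and> P A x}"

definition rel2 :: "((complex, real, 'a) cstar \<Rightarrow> 'a \<Rightarrow> 'a \<Rightarrow> bool) \<Rightarrow> 'v list set" where
  "rel2 P = {[emb_alg U A, emb_point U x, emb_point U y] | A x y.
     cstar_algebra A \<and> x \<in> carrier A \<and> y \<in> carrier A \<and> P A x y}"

definition rel3 :: "((complex, real, 'a) cstar \<Rightarrow> 'a \<Rightarrow> 'a \<Rightarrow> 'a \<Rightarrow> bool) \<Rightarrow> 'v list set" where
  "rel3 P = {[emb_alg U A, emb_point U x, emb_point U y, emb_point U z] | A x y z.
     cstar_algebra A \<and> x \<in> carrier A \<and> y \<in> carrier A \<and> z \<in> carrier A \<and> P A x y z}"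

lemmas rel_defs = rel1_def rel2_def rel3_def

end

section \<open>Internal algebras and their hulls\<close>

text \<open>Facts with the algebra as an explicit variable: in goals produced by
  \<open>transfer\<close> it is bound, and no locale interpretation is at hand.\<close>

lemma cstar_ring_simprules:
  assumes "cstar_algebra A"
  shows "\<zero>\<^bsub>A\<^esub> \<in> carrier A"
    and "x \<in> carrier A \<Longrightarrow> \<ominus>\<^bsub>A\<^esub> x \<in> carrier A"
    and "\<lbrakk>x \<in> carrier A; y \<in> carrier A\<rbrakk> \<Longrightarrow> x \<oplus>\<^bsub>A\<^esub> y \<in> carrier A"
    and "\<lbrakk>x \<in> carrier A; y \<in> carrier A\<rbrakk> \<Longrightarrow> x \<ominus>\<^bsub>A\<^esub> y \<in> carrier A"
    and "\<lbrakk>x \<in> carrier A; y \<in> carrier A\<rbrakk> \<Longrightarrow> x \<otimes>\<^bsub>A\<^esub> y \<in> carrier A"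
    and "x \<in> carrier A \<Longrightarrow> x \<oplus>\<^bsub>A\<^esub> \<ominus>\<^bsub>A\<^esub> x = \<zero>\<^bsub>A\<^esub>"
    and "x \<in> carrier A \<Longrightarrow> \<ominus>\<^bsub>A\<^esub> x \<oplus>\<^bsub>A\<^esub> x = \<zero>\<^bsub>A\<^esub>"
proof -
  interpret cstar_algebra A by fact
  show "\<zero>\<^bsub>A\<^esub> \<in> carrier A"
    and "x \<in> carrier A \<Longrightarrow> \<ominus>\<^bsub>A\<^esub> x \<in> carrier A"
    and "\<lbrakk>x \<in> carrier A; y \<in> carrier A\<rbrakk> \<Longrightarrow> x \<oplus>\<^bsub>A\<^esub> y \<in> carrier A"
    and "\<lbrakk>x \<in> carrier A; y \<in> carrier A\<rbrakk> \<Longrightarrow> x \<ominus>\<^bsub>A\<^esub> y \<in> carrier A"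
    and "\<lbrakk>x \<in> carrier A; y \<in> carrier A\<rbrakk> \<Longrightarrow> x \<otimes>\<^bsub>A\<^esub> y \<in> carrier A"
    and "x \<in> carrier A \<Longrightarrow> x \<oplus>\<^bsub>A\<^esub> \<ominus>\<^bsub>A\<^esub> x = \<zero>\<^bsub>A\<^esub>"
    and "x \<in> carrier A \<Longrightarrow> \<ominus>\<^bsub>A\<^esub> x \<oplus>\<^bsub>A\<^esub> x = \<zero>\<^bsub>A\<^esub>"
    by (simp_all add: r_neg l_neg)
qed

lemma cstar_minus_unique:
  assumes "cstar_algebra A" "x \<in> carrier A" "y \<in> carrier A" "x \<oplus>\<^bsub>A\<^esub> y = \<zero>\<^bsub>A\<^esub>"
  shows "y = \<ominus>\<^bsub>A\<^esub> x"
proof -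
  interpret cstar_algebra A by fact
  show ?thesis using assms by (metis a_comm minus_equality)
qed

locale internal_cstar = universe U for U :: "('a, 'v, 'w) extension" +
  fixes M :: 'w
  assumes internal: "internal_cstar_algebra U M"
begin

abbreviation N :: "('w, 'w, 'w) cstar" where
  "N \<equiv> internal_alg U M"

lemma M_mem: "[M] \<in> star_rel U {[emb_alg U A] | A. cstar_algebra A}"
  using internal by (simp add: internal_cstar_algebra_def)

section \<open>Extensions of the operations\<close>

text \<open>The relation defining the carrier ranges over all records. At \<open>M\<close>, which
  lies in the extension of the set of C*-algebras, it agrees with the relation restricted to
  these.\<close>

lemma carrier_iff: "a \<in> carrier N \<longleftrightarrow> [M, a] \<in> star_rel U (rel1 (\<lambda>A x. True))"
proof -
  \<comment> \<open>The list after \<open>(!)\<close> is the assignment, its i-th entry being the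
    value of variable i. Here and below, variable 0 is the algebra \<open>M\<close>.\<close>
  have "sat (star_rel U)
      (FImp (FRel {[emb_alg U A] | A. cstar_algebra A} [0])
        (FIff (FRel {[emb_alg U A, emb_point U x] | A x. x \<in> carrier A} [0, 1])
          (FRel (rel1 (\<lambda>A x. True)) [0, 1]))) ((!) [M, a])"
    by (rule transfer) (auto simp: rel_defs)
  then show ?thesis using M_mem by (simp add: internal_alg_def)
qed

lemma rel1_carrier: "[M, a] \<in> star_rel U (rel1 P) \<Longrightarrow> a \<in> carrier N"
proof -
  have "sat (star_rel U) (FImp (FRel (rel1 P) [0, 1]) (FRel (rel1 (\<lambda>A x. True)) [0, 1])) ((!) [M, a])"
    by (rule transfer) (auto simp: rel_defs)
  then show "[M, a] \<in> star_rel U (rel1 P) \<Longrightarrow> a \<in> carrier N" by (simp add: carrier_iff)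
qed

lemma rel2_carrier:
  assumes "[M, a, b] \<in> star_rel U (rel2 P)"
  shows "a \<in> carrier N" "b \<in> carrier N"
proof -
  have "sat (star_rel U) (FImp (FRel (rel2 P) [0, 1, 2])
      (FAnd (FRel (rel1 (\<lambda>A x. True)) [0, 1]) (FRel (rel1 (\<lambda>A x. True)) [0, 2]))) ((!) [M, a, b])"
    by (rule transfer) (auto simp: rel_defs)
  then show "a \<in> carrier N" "b \<in> carrier N" using assms by (simp_all add: carrier_iff)
qed

lemma rel3_carrier:
  assumes "[M, a, b, c] \<in> star_rel U (rel3 P)"
  shows "c \<in> carrier N"
proof -
  have "sat (star_rel U) (FImp (FRel (rel3 P) [0, 1, 2, 3])
      (FRel (rel1 (\<lambda>A x. True)) [0, 3])) ((!) [M, a, b, c])"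
    by (rule transfer) (auto simp: rel_defs)
  then show "c \<in> carrier N" using assms by (simp add: carrier_iff)
qed

text \<open>Transfer gives a value lying in both the defining graph \<open>G\<close> and its
  restriction to C*-algebras; functionality of \<open>G\<close> identifies it with the definite
  description. Multiplication and addition are both instances.\<close>

lemma internal_binop:
  fixes f :: "(complex, real, 'a) cstar \<Rightarrow> 'a \<Rightarrow> 'a \<Rightarrow> 'a"
  assumes closed: "\<And>A x y. \<lbrakk>cstar_algebra A; x \<in> carrier A; y \<in> carrier A\<rbrakk> \<Longrightarrow> f A x y \<in> carrier A"
    and ab: "a \<in> carrier N" "b \<in> carrier N"
  defines "G \<equiv> {[emb_alg U A, emb_point U x, emb_point U y, emb_point U (f A x y)] | A x y. True}"
  shows "[M, a, b, THE c. [M, a, b, c] \<in> star_rel U G] \<in> star_rel U (rel3 (\<lambda>A x y z. z = f A x y))"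
proof -
  have "sat (star_rel U)
      (FImp (FRel (rel1 (\<lambda>A x. True)) [0, 1]) (FImp (FRel (rel1 (\<lambda>A x. True)) [0, 2])
        (FEx 3 (FAnd (FRel (rel3 (\<lambda>A x y z. z = f A x y)) [0, 1, 2, 3])
          (FRel G [0, 1, 2, 3]))))) ((!) [M, a, b])"
    by (rule transfer) (auto simp: rel_defs G_def closed)
  then obtain c where c: "[M, a, b, c] \<in> star_rel U (rel3 (\<lambda>A x y z. z = f A x y))"
    "[M, a, b, c] \<in> star_rel U G"
    using ab by (auto simp: carrier_iff)
  have "(THE c. [M, a, b, c] \<in> star_rel U G) = c"
    by (rule star_the_equality[where as = "[M, a, b]", unfolded append.simps])
      (use c(2) in \<open>auto simp: snoc_eq_iff_butlast G_def\<close>)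
  with c(1) show ?thesis by simp
qed

lemma mult_mem:
  "\<lbrakk>a \<in> carrier N; b \<in> carrier N\<rbrakk> \<Longrightarrow>
    [M, a, b, a \<otimes>\<^bsub>N\<^esub> b] \<in> star_rel U (rel3 (\<lambda>A x y z. z = x \<otimes>\<^bsub>A\<^esub> y))"
  using internal_binop[of "\<lambda>A x y. x \<otimes>\<^bsub>A\<^esub> y" a b]
  by (simp add: internal_alg_def cstar_ring_simprules)

lemma add_mem:
  "\<lbrakk>a \<in> carrier N; b \<in> carrier N\<rbrakk> \<Longrightarrow>
    [M, a, b, a \<oplus>\<^bsub>N\<^esub> b] \<in> star_rel U (rel3 (\<lambda>A x y z. z = x \<oplus>\<^bsub>A\<^esub> y))"
  using internal_binop[of "\<lambda>A x y. x \<oplus>\<^bsub>A\<^esub> y" a b]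
  by (simp add: internal_alg_def cstar_ring_simprules)

lemma adj_mem:
  assumes a: "a \<in> carrier N"
  shows "[M, a, adj N a] \<in> star_rel U (rel2 (\<lambda>A x y. y = adj A x))"
proof -
  let ?G = "{[emb_alg U A, emb_point U x, emb_point U (adj A x)] | A x. True}"
  have "sat (star_rel U)
      (FImp (FRel (rel1 (\<lambda>A x. True)) [0, 1])
        (FEx 2 (FAnd (FRel (rel2 (\<lambda>A x y. y = adj A x)) [0, 1, 2]) (FRel ?G [0, 1, 2])))) ((!) [M, a])"
    by (rule transfer) (auto simp: rel_defs cstar_algebra.adj_closed)
  then obtain c where c: "[M, a, c] \<in> star_rel U (rel2 (\<lambda>A x y. y = adj A x))"
    "[M, a, c] \<in> star_rel U ?G"
    using a by (auto simp: carrier_iff)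
  have "(THE c. [M, a, c] \<in> star_rel U ?G) = c"
    by (rule star_the_equality[where as = "[M, a]", unfolded append.simps])
      (use c(2) in \<open>auto simp: snoc_eq_iff_butlast\<close>)
  with c(1) show ?thesis by (simp add: internal_alg_def)
qed

text \<open>The relation is written out because its last entry is a number and not a point, unlike
  in \<open>rel2\<close>.\<close>

lemma norm_mem:
  assumes a: "a \<in> carrier N"
  shows "[M, a, alg_norm N a] \<in> star_rel U {[emb_alg U A, emb_point U x, emb_real U (alg_norm A x)] | A x.
    cstar_algebra A \<and> x \<in> carrier A}"
proof -
  let ?G = "{[emb_alg U A, emb_point U x, emb_real U (alg_norm A x)] | A x. True}"
  let ?H = "{[emb_alg U A, emb_point U x, emb_real U (alg_norm A x)] | A x.
    cstar_algebra A \<and> x \<in> carrier A}"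
  have "sat (star_rel U)
      (FImp (FRel (rel1 (\<lambda>A x. True)) [0, 1])
        (FEx 2 (FAnd (FRel ?H [0, 1, 2]) (FRel ?G [0, 1, 2])))) ((!) [M, a])"
    by (rule transfer) (auto simp: rel_defs)
  then obtain c where c: "[M, a, c] \<in> star_rel U ?H" "[M, a, c] \<in> star_rel U ?G"
    using a by (auto simp: carrier_iff)
  have "(THE c. [M, a, c] \<in> star_rel U ?G) = c"
    by (rule star_the_equality[where as = "[M, a]", unfolded append.simps])
      (use c(2) in \<open>auto simp: snoc_eq_iff_butlast\<close>)
  with c(1) show ?thesis by (simp add: internal_alg_def)
qed

lemma zero_mem: "[M, \<zero>\<^bsub>N\<^esub>] \<in> star_rel U (rel1 (\<lambda>A x. x = \<zero>\<^bsub>A\<^esub>))"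
proof -
  let ?G = "{[emb_alg U A, emb_point U \<zero>\<^bsub>A\<^esub>] | A. True}"
  have "sat (star_rel U)
      (FImp (FRel {[emb_alg U A] | A. cstar_algebra A} [0])
        (FEx 1 (FAnd (FRel (rel1 (\<lambda>A x. x = \<zero>\<^bsub>A\<^esub>)) [0, 1]) (FRel ?G [0, 1])))) ((!) [M])"
    by (rule transfer) (auto simp: rel_defs cstar_ring_simprules)
  then obtain c where c: "[M, c] \<in> star_rel U (rel1 (\<lambda>A x. x = \<zero>\<^bsub>A\<^esub>))"
    "[M, c] \<in> star_rel U ?G"
    using M_mem by auto
  have "(THE c. [M, c] \<in> star_rel U ?G) = c"
    by (rule star_the_equality[where as = "[M]", unfolded append.simps])
      (use c(2) in \<open>auto simp: snoc_eq_iff_butlast\<close>)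
  with c(1) show ?thesis by (simp add: internal_alg_def)
qed

text \<open>Negation in \<open>N\<close> is derived from its addition by a definite description, not
  read off an extended graph. Transfer supplies a candidate \<open>c\<close> and shows that it is a
  two-sided and unique inverse.\<close>

lemma uminus_mem:
  assumes b: "b \<in> carrier N"
  shows "[M, b, \<ominus>\<^bsub>N\<^esub> b] \<in> star_rel U (rel2 (\<lambda>A x y. y = \<ominus>\<^bsub>A\<^esub> x))"
proof -
  let ?H = "rel2 (\<lambda>A x y. y = \<ominus>\<^bsub>A\<^esub> x)" and ?S = "rel3 (\<lambda>A x y z. z = x \<oplus>\<^bsub>A\<^esub> y)"
  have "sat (star_rel U)
      (FImp (FRel (rel1 (\<lambda>A x. True)) [0, 1]) (FEx 2 (FRel ?H [0, 1, 2]))) ((!) [M, b])"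
    by (rule transfer)
      (auto simp: rel_defs cstar_ring_simprules)
  then obtain c where c: "[M, b, c] \<in> star_rel U ?H"
    using b by (auto simp: carrier_iff)
  have cc: "c \<in> carrier N" using c by (rule rel2_carrier)
  have "sat (star_rel U)
      (FImp (FRel ?H [0, 1, 2]) (FImp (FRel (rel1 (\<lambda>A x. x = \<zero>\<^bsub>A\<^esub>)) [0, 3])
        (FAnd (FImp (FRel ?S [0, 1, 2, 4]) (FEq 4 3)) (FImp (FRel ?S [0, 2, 1, 5]) (FEq 5 3)))))
      ((!) [M, b, c, \<zero>\<^bsub>N\<^esub>, b \<oplus>\<^bsub>N\<^esub> c, c \<oplus>\<^bsub>N\<^esub> b])"
    by (rule transfer) (auto simp: rel_defs cstar_ring_simprules)
  then have inv: "b \<oplus>\<^bsub>N\<^esub> c = \<zero>\<^bsub>N\<^esub>" "c \<oplus>\<^bsub>N\<^esub> b = \<zero>\<^bsub>N\<^esub>"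
    using c zero_mem add_mem b cc by simp_all
  have unique: "d = c" if d: "d \<in> carrier N" "b \<oplus>\<^bsub>N\<^esub> d = \<zero>\<^bsub>N\<^esub>" for d
  proof -
    have "sat (star_rel U)
        (FImp (FRel ?H [0, 1, 2]) (FImp (FRel (rel1 (\<lambda>A x. x = \<zero>\<^bsub>A\<^esub>)) [0, 3])
          (FImp (FRel ?S [0, 1, 4, 3]) (FEq 4 2)))) ((!) [M, b, c, \<zero>\<^bsub>N\<^esub>, d])"
      by (rule transfer) (auto simp: rel_defs dest: cstar_minus_unique)
    then show ?thesis using c zero_mem add_mem[OF b d(1)] d(2) by simp
  qed
  have "\<ominus>\<^bsub>N\<^esub> b = c"
    unfolding a_inv_def m_inv_def
    by (rule the_equality) (simp add: cc inv, rule unique, simp_all)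
  with c show ?thesis by simp
qed

lemma minus_mem:
  assumes "a \<in> carrier N" "b \<in> carrier N"
  shows "[M, a, b, a \<ominus>\<^bsub>N\<^esub> b] \<in> star_rel U (rel3 (\<lambda>A x y z. z = x \<ominus>\<^bsub>A\<^esub> y))"
proof -
  have "sat (star_rel U)
      (FImp (FRel (rel2 (\<lambda>A x y. y = \<ominus>\<^bsub>A\<^esub> x)) [0, 2, 3])
        (FImp (FRel (rel3 (\<lambda>A x y z. z = x \<oplus>\<^bsub>A\<^esub> y)) [0, 1, 3, 4])
          (FRel (rel3 (\<lambda>A x y z. z = x \<ominus>\<^bsub>A\<^esub> y)) [0, 1, 2, 4])))
      ((!) [M, a, b, \<ominus>\<^bsub>N\<^esub> b, a \<ominus>\<^bsub>N\<^esub> b])"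
    by (rule transfer) (auto simp: rel_defs a_minus_def)
  moreover have "\<ominus>\<^bsub>N\<^esub> b \<in> carrier N"
    using uminus_mem[OF assms(2)] by (rule rel2_carrier)
  ultimately show ?thesis
    using uminus_mem[OF assms(2)] add_mem[of a "\<ominus>\<^bsub>N\<^esub> b"] assms by (simp add: a_minus_def)
qed

section \<open>Norms compared with standard reals\<close>

lemma habs_norm:
  assumes a: "a \<in> carrier N"
  shows "habs U (alg_norm N a) = alg_norm N a"
proof -
  let ?r = "alg_norm N a"
  let ?R = "{[emb_alg U A, emb_point U x, emb_real U (alg_norm A x)] | A x.
      cstar_algebra A \<and> x \<in> carrier A}"
  let ?A = "{[emb_real U x, emb_real U \<bar>x\<bar>] | x. True}"
  have "sat (star_rel U) (FImp (FRel ?R [0, 1, 2]) (FRel ?A [2, 2])) ((!) [M, a, ?r])"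
    by (rule transfer) (auto simp: cstar_algebra.norm_nonneg)
  then have "[?r, ?r] \<in> star_rel U ?A"
    using norm_mem[OF a] by simp
  then show ?thesis
    unfolding habs_def
    by (intro star_the_equality[where as = "[?r]", unfolded append.simps])
      (auto simp: snoc_eq_iff_butlast)
qed

lemma hminus_norm_zero:
  assumes a: "a \<in> carrier N"
  shows "hminus U (alg_norm N a) (star U (emb_real U 0)) = alg_norm N a"
proof -
  let ?r = "alg_norm N a" and ?z = "star U (emb_real U 0)"
  let ?R = "{[emb_alg U A, emb_point U x, emb_real U (alg_norm A x)] | A x.
      cstar_algebra A \<and> x \<in> carrier A}"
  let ?S = "{[emb_real U x, emb_real U y, emb_real U (x - y)] | x y. True}"
  have "sat (star_rel U) (FImp (FRel ?R [0, 1, 2]) (FImp (FRel {[emb_real U 0]} [3])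
      (FRel ?S [2, 3, 2]))) ((!) [M, a, ?r, ?z])"
    by (rule transfer) auto
  then have "[?r, ?z, ?r] \<in> star_rel U ?S"
    using norm_mem[OF a] star_mem_singleton[of "emb_real U 0"] by simp
  then show ?thesis
    unfolding hminus_def
    by (intro star_the_equality[where as = "[?r, ?z]", unfolded append.simps])
      (auto simp: snoc_eq_iff_butlast)
qed

text \<open>Turns a hyperreal comparison into a relation on algebra elements, so that estimates can
  be made with real norms before transfer.\<close>

lemma hless_norm_iff:
  assumes a: "a \<in> carrier N"
  shows "hless U (alg_norm N a) (star U (emb_real U c)) \<longleftrightarrow>
    [M, a] \<in> star_rel U (rel1 (\<lambda>A x. alg_norm A x < c))"
proof -
  let ?r = "alg_norm N a"
  let ?R = "{[emb_alg U A, emb_point U x, emb_real U (alg_norm A x)] | A x.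
      cstar_algebra A \<and> x \<in> carrier A}"
  have "sat (star_rel U) (FImp (FRel ?R [0, 1, 2]) (FImp (FRel {[emb_real U c]} [3])
      (FIff (FRel {[emb_real U x, emb_real U y] | x y. x < y} [2, 3])
        (FRel (rel1 (\<lambda>A x. alg_norm A x < c)) [0, 1])))) ((!) [M, a, ?r, star U (emb_real U c)])"
    by (rule transfer) (auto simp: rel_defs)
  then show ?thesis
    using norm_mem[OF a] star_mem_singleton[of "emb_real U c"] by (simp add: hless_def)
qed

lemma happrox_zero_iff:
  assumes a: "a \<in> carrier N"
  shows "happrox U (alg_norm N a) (star U (emb_real U 0)) \<longleftrightarrow>
    (\<forall>n::nat. 1 \<le> n \<longrightarrow> [M, a] \<in> star_rel U (rel1 (\<lambda>A x. alg_norm A x < 1 / real n)))"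
  unfolding happrox_def hminus_norm_zero[OF a] habs_norm[OF a] hless_norm_iff[OF a] ..

section \<open>Infinitesimal closeness\<close>

text \<open>Closeness is external, but for each standard \<open>n\<close> its condition is an
  extended relation. Later proofs transfer one \<open>n\<close> at a time.\<close>

lemma approx_iff:
  assumes "a \<in> carrier N" "b \<in> carrier N"
  shows "approx U M a b \<longleftrightarrow> (\<forall>n::nat. 1 \<le> n \<longrightarrow>
    [M, a, b] \<in> star_rel U (rel2 (\<lambda>A x y. alg_norm A (x \<ominus>\<^bsub>A\<^esub> y) < 1 / real n)))"
proof -
  let ?d = "a \<ominus>\<^bsub>N\<^esub> b"
  have m: "[M, a, b, ?d] \<in> star_rel U (rel3 (\<lambda>A x y z. z = x \<ominus>\<^bsub>A\<^esub> y))"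
    by (rule minus_mem[OF assms])
  have d: "?d \<in> carrier N" using m by (rule rel3_carrier)
  have "[M, ?d] \<in> star_rel U (rel1 (\<lambda>A x. alg_norm A x < c)) \<longleftrightarrow>
      [M, a, b] \<in> star_rel U (rel2 (\<lambda>A x y. alg_norm A (x \<ominus>\<^bsub>A\<^esub> y) < c))" for c
  proof -
    have "sat (star_rel U)
        (FImp (FRel (rel3 (\<lambda>A x y z. z = x \<ominus>\<^bsub>A\<^esub> y)) [0, 1, 2, 3])
          (FIff (FRel (rel1 (\<lambda>A x. alg_norm A x < c)) [0, 3])
            (FRel (rel2 (\<lambda>A x y. alg_norm A (x \<ominus>\<^bsub>A\<^esub> y) < c)) [0, 1, 2]))) ((!) [M, a, b, ?d])"
      by (rule transfer) (auto simp: rel_defs)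
    then show ?thesis using m by simp
  qed
  then show ?thesis unfolding approx_def happrox_zero_iff[OF d] by simp
qed

lemma approxD:
  "approx U M a b \<Longrightarrow> a \<in> carrier N \<Longrightarrow> b \<in> carrier N \<Longrightarrow> 1 \<le> n \<Longrightarrow>
    [M, a, b] \<in> star_rel U (rel2 (\<lambda>A x y. alg_norm A (x \<ominus>\<^bsub>A\<^esub> y) < 1 / real n))"
  by (simp add: approx_iff)

lemma approx_refl: 
  assumes "a \<in> carrier N"
  shows "approx U M a a"
proof -
  have "sat (star_rel U)
      (FImp (FRel (rel1 (\<lambda>A x. True)) [0, 1])
        (FRel (rel2 (\<lambda>A x y. alg_norm A (x \<ominus>\<^bsub>A\<^esub> y) < 1 / real n)) [0, 1, 1])) ((!) [M, a])"
    if "1 \<le> n" for n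
    by (rule transfer)
      (use that in \<open>auto simp: rel_defs cstar_algebra.norm_minus_self\<close>)
  then show ?thesis using assms by (simp add: approx_iff carrier_iff)
qed

lemma approx_sym:
  assumes "approx U M a b" "a \<in> carrier N" "b \<in> carrier N"
  shows "approx U M b a"
proof -
  let ?D = "\<lambda>n::nat. rel2 (\<lambda>A x y. alg_norm A (x \<ominus>\<^bsub>A\<^esub> y) < 1 / real n)"
  have "sat (star_rel U) (FImp (FRel (?D n) [0, 1, 2]) (FRel (?D n) [0, 2, 1])) ((!) [M, a, b])" for n
    by (rule transfer) (auto simp: rel_defs cstar_algebra.norm_minus_commute)
  then show ?thesis using assms by (simp add: approx_iff)
qed

lemma approx_trans:
  assumes "approx U M a b" "approx U M b c" "a \<in> carrier N" "b \<in> carrier N" "c \<in> carrier N"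
  shows "approx U M a c"
proof -
  let ?D = "\<lambda>n::nat. rel2 (\<lambda>A x y. alg_norm A (x \<ominus>\<^bsub>A\<^esub> y) < 1 / real n)"
  have "[M, a, c] \<in> star_rel U (?D n)" if n: "1 \<le> n" for n
  proof -
    have "alg_norm A (x \<ominus>\<^bsub>A\<^esub> z) < 1 / real n"
      if "cstar_algebra A" "x \<in> carrier A" "y \<in> carrier A" "z \<in> carrier A"
        "alg_norm A (x \<ominus>\<^bsub>A\<^esub> y) < 1 / real (2 * n)" "alg_norm A (y \<ominus>\<^bsub>A\<^esub> z) < 1 / real (2 * n)"
      for A :: "(complex, real, 'a) cstar" and x y z
      using cstar_algebra.norm_minus_triangle[of A x y z] that by (simp add: field_simps)
    then have "sat (star_rel U)
        (FImp (FRel (?D (2 * n)) [0, 1, 2]) (FImp (FRel (?D (2 * n)) [0, 2, 3]) (FRel (?D n) [0, 1, 3])))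
        ((!) [M, a, b, c])"
      by (intro transfer) (auto simp: rel_defs)
    then show ?thesis
      using approxD[of a b "2 * n"] approxD[of b c "2 * n"] assms n by simp
  qed
  then show ?thesis using assms by (simp add: approx_iff)
qed

lemma hat_eq_iff:
  assumes "a \<in> carrier N" "b \<in> carrier N"
  shows "hat U M a = hat U M b \<longleftrightarrow> approx U M a b"
proof
  assume "hat U M a = hat U M b"
  then show "approx U M a b" using approx_refl[OF assms(1)] assms by (auto simp: hat_def)
next
  assume "approx U M a b"
  then have "approx U M x a \<longleftrightarrow> approx U M x b" if "x \<in> carrier N" for x
    by (metis approx_trans approx_sym assms that)
  then show "hat U M a = hat U M b"
    unfolding hat_def by (intro Collect_cong conj_cong refl)
qed

section \<open>Finite elements and compatibility of the operations with closeness\<close>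

lemma Fin_iff: "a \<in> Fin U M \<longleftrightarrow>
  (\<exists>n::nat. [M, a] \<in> star_rel U (rel1 (\<lambda>A x. alg_norm A x < real n)))"
proof -
  have "hfinite U (alg_norm N a) \<longleftrightarrow>
      (\<exists>n::nat. [M, a] \<in> star_rel U (rel1 (\<lambda>A x. alg_norm A x < real n)))" if a: "a \<in> carrier N"
    unfolding hfinite_def habs_norm[OF a] hless_norm_iff[OF a] ..
  then show ?thesis by (auto simp: Fin_def dest: rel1_carrier)
qed

lemma Fin_carrier: "a \<in> Fin U M \<Longrightarrow> a \<in> carrier N"
  by (simp add: Fin_def)

lemma mult_closed: "\<lbrakk>a \<in> carrier N; b \<in> carrier N\<rbrakk> \<Longrightarrow> a \<otimes>\<^bsub>N\<^esub> b \<in> carrier N"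
  using mult_mem rel3_carrier by blast

lemma adj_closed: "a \<in> carrier N \<Longrightarrow> adj N a \<in> carrier N"
  using adj_mem rel2_carrier(2) by blast

text \<open>Ensures that an element found close to a finite one represents a member of the
  hull.\<close>

lemma Fin_approx:
  assumes "a \<in> Fin U M" "b \<in> carrier N" "approx U M b a"
  shows "b \<in> Fin U M"
proof -
  obtain n :: nat where n: "[M, a] \<in> star_rel U (rel1 (\<lambda>A x. alg_norm A x < real n))"
    using assms by (auto simp: Fin_iff)
  have "alg_norm A y < real (Suc n)"
    if "cstar_algebra A" "x \<in> carrier A" "y \<in> carrier A"
      "alg_norm A x < real n" "alg_norm A (y \<ominus>\<^bsub>A\<^esub> x) < 1 / real 1"
    for A :: "(complex, real, 'a) cstar" and x y
    using cstar_algebra.norm_le_add_minus[of A y x] that by simp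
  then have "sat (star_rel U)
      (FImp (FRel (rel1 (\<lambda>A x. alg_norm A x < real n)) [0, 1])
        (FImp (FRel (rel2 (\<lambda>A x y. alg_norm A (x \<ominus>\<^bsub>A\<^esub> y) < 1 / real 1)) [0, 2, 1])
          (FRel (rel1 (\<lambda>A x. alg_norm A x < real (Suc n))) [0, 2]))) ((!) [M, a, b])"
    by (intro transfer) (auto simp: rel_defs)
  then have "[M, b] \<in> star_rel U (rel1 (\<lambda>A x. alg_norm A x < real (Suc n)))"
    using n approxD[of b a 1] assms Fin_carrier by simp
  then show ?thesis unfolding Fin_iff by blast
qed

lemma Fin_adj:
  assumes "a \<in> Fin U M"
  shows "adj N a \<in> Fin U M"
proof -
  obtain n :: nat where n: "[M, a] \<in> star_rel U (rel1 (\<lambda>A x. alg_norm A x < real n))"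
    using assms by (auto simp: Fin_iff)
  have "sat (star_rel U)
      (FImp (FRel (rel1 (\<lambda>A x. alg_norm A x < real n)) [0, 1])
        (FImp (FRel (rel2 (\<lambda>A x y. y = adj A x)) [0, 1, 2])
          (FRel (rel1 (\<lambda>A x. alg_norm A x < real n)) [0, 2]))) ((!) [M, a, adj N a])"
    by (rule transfer) (auto simp: rel_defs cstar_algebra.norm_adj)
  then show ?thesis
    using n adj_mem[OF Fin_carrier[OF assms]] by (auto simp: Fin_iff)
qed

lemma Fin_mult:
  assumes "a \<in> Fin U M" "b \<in> Fin U M"
  shows "a \<otimes>\<^bsub>N\<^esub> b \<in> Fin U M"
proof -
  obtain k n :: nat where n: "[M, a] \<in> star_rel U (rel1 (\<lambda>A x. alg_norm A x < real k))"
    "[M, b] \<in> star_rel U (rel1 (\<lambda>A x. alg_norm A x < real n))"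
    using assms by (auto simp: Fin_iff)
  have "alg_norm A (x \<otimes>\<^bsub>A\<^esub> y) < real (k * n)"
    if "cstar_algebra A" "x \<in> carrier A" "y \<in> carrier A" "alg_norm A x < real k" "alg_norm A y < real n"
    for A :: "(complex, real, 'a) cstar" and x y
    using cstar_algebra.norm_mult[of A x y] that
      mult_strict_mono'[of "alg_norm A x" "real k" "alg_norm A y" "real n"]
    by (simp add: cstar_algebra.norm_nonneg)
  then have "sat (star_rel U)
      (FImp (FRel (rel1 (\<lambda>A x. alg_norm A x < real k)) [0, 1])
        (FImp (FRel (rel1 (\<lambda>A x. alg_norm A x < real n)) [0, 2])
          (FImp (FRel (rel3 (\<lambda>A x y z. z = x \<otimes>\<^bsub>A\<^esub> y)) [0, 1, 2, 3])
            (FRel (rel1 (\<lambda>A x. alg_norm A x < real (k * n))) [0, 3])))) ((!) [M, a, b, a \<otimes>\<^bsub>N\<^esub> b])"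
    by (intro transfer) (auto simp: rel_defs)
  then have "[M, a \<otimes>\<^bsub>N\<^esub> b] \<in> star_rel U (rel1 (\<lambda>A x. alg_norm A x < real (k * n)))"
    using n mult_mem[of a b] assms Fin_carrier by simp
  then show ?thesis unfolding Fin_iff by blast
qed

lemma approx_adj:
  assumes "approx U M a b" "a \<in> carrier N" "b \<in> carrier N"
  shows "approx U M (adj N a) (adj N b)"
proof -
  let ?D = "\<lambda>n::nat. rel2 (\<lambda>A x y. alg_norm A (x \<ominus>\<^bsub>A\<^esub> y) < 1 / real n)"
    and ?J = "rel2 (\<lambda>A x y. y = adj A x)"
  have "alg_norm A (adj A x \<ominus>\<^bsub>A\<^esub> adj A y) = alg_norm A (x \<ominus>\<^bsub>A\<^esub> y)"
    if "cstar_algebra A" "x \<in> carrier A" "y \<in> carrier A"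
    for A :: "(complex, real, 'a) cstar" and x y
    using cstar_algebra.norm_adj[of A "x \<ominus>\<^bsub>A\<^esub> y"] cstar_algebra.adj_minus[of A x y] that
    by (simp add: cstar_ring_simprules)
  then have "sat (star_rel U)
      (FImp (FRel (?D n) [0, 1, 2]) (FImp (FRel ?J [0, 1, 3]) (FImp (FRel ?J [0, 2, 4])
        (FRel (?D n) [0, 3, 4])))) ((!) [M, a, b, adj N a, adj N b])" for n
    by (intro transfer) (auto simp: rel_defs)
  then show ?thesis
    using assms adj_mem[OF assms(2)] adj_mem[OF assms(3)] by (simp add: approx_iff adj_closed)
qed

text \<open>From \<open>x y - x' y' = x (y - y') + (x - x') y'\<close>: norm bounds enter only for
  the first left factor and the second right factor, hence the asymmetric finiteness
  hypotheses.\<close>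

lemma approx_mult:
  assumes "a \<in> Fin U M" "b' \<in> Fin U M" "a' \<in> carrier N" "b \<in> carrier N"
    and "approx U M a a'" "approx U M b b'"
  shows "approx U M (a \<otimes>\<^bsub>N\<^esub> b) (a' \<otimes>\<^bsub>N\<^esub> b')"
proof -
  let ?D = "\<lambda>n::nat. rel2 (\<lambda>A x y. alg_norm A (x \<ominus>\<^bsub>A\<^esub> y) < 1 / real n)"
    and ?B = "\<lambda>n::nat. rel1 (\<lambda>A x. alg_norm A x < real n)"
    and ?P = "rel3 (\<lambda>A x y z. z = x \<otimes>\<^bsub>A\<^esub> y)"
  obtain k l where k: "[M, a] \<in> star_rel U (?B k)" and l: "[M, b'] \<in> star_rel U (?B l)"
    using assms by (auto simp: Fin_iff)
  have carr: "a \<in> carrier N" "b' \<in> carrier N" using assms Fin_carrier by auto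
  have "[M, a \<otimes>\<^bsub>N\<^esub> b, a' \<otimes>\<^bsub>N\<^esub> b'] \<in> star_rel U (?D n)" if n: "1 \<le> n" for n
  proof -
    \<comment> \<open>The summand 1 makes \<open>(k + l) / ?m < 1 / n\<close> strict and keeps
      \<open>?m\<close> positive when \<open>k + l = 0\<close>.\<close>
    let ?m = "(k + l) * n + 1"
    have "alg_norm A (x \<otimes>\<^bsub>A\<^esub> y \<ominus>\<^bsub>A\<^esub> x' \<otimes>\<^bsub>A\<^esub> y') < 1 / real n"
      if A: "cstar_algebra A" and c: "x \<in> carrier A" "y \<in> carrier A" "x' \<in> carrier A" "y' \<in> carrier A"
        and b: "alg_norm A x < real k" "alg_norm A y' < real l"
          "alg_norm A (x \<ominus>\<^bsub>A\<^esub> x') < 1 / real ?m" "alg_norm A (y \<ominus>\<^bsub>A\<^esub> y') < 1 / real ?m"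
      for A :: "(complex, real, 'a) cstar" and x y x' y'
    proof -
      have cl: "x \<ominus>\<^bsub>A\<^esub> x' \<in> carrier A" "y \<ominus>\<^bsub>A\<^esub> y' \<in> carrier A"
        using A c by (simp_all add: cstar_ring_simprules)
      have "alg_norm A (x \<otimes>\<^bsub>A\<^esub> y \<ominus>\<^bsub>A\<^esub> x' \<otimes>\<^bsub>A\<^esub> y') \<le>
          alg_norm A x * alg_norm A (y \<ominus>\<^bsub>A\<^esub> y') + alg_norm A (x \<ominus>\<^bsub>A\<^esub> x') * alg_norm A y'"
        using A c by (rule cstar_algebra.norm_mult_minus_mult)
      also have "\<dots> \<le> real k * (1 / real ?m) + (1 / real ?m) * real l"
        using b A c cl by (intro add_mono mult_mono) (auto simp: cstar_algebra.norm_nonneg less_imp_le)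
      also have "\<dots> = real (k + l) / real ?m" by (simp add: add_divide_distrib)
      also have "\<dots> < 1 / real n"
        using n by (simp add: divide_less_eq less_divide_eq field_simps) (simp add: not_less)
      finally show ?thesis .
    qed
    then have "sat (star_rel U)
        (FImp (FRel (?B k) [0, 1]) (FImp (FRel (?B l) [0, 4])
          (FImp (FRel (?D ?m) [0, 1, 3]) (FImp (FRel (?D ?m) [0, 2, 4])
            (FImp (FRel ?P [0, 1, 2, 5]) (FImp (FRel ?P [0, 3, 4, 6])
              (FRel (?D n) [0, 5, 6]))))))) ((!) [M, a, b, a', b', a \<otimes>\<^bsub>N\<^esub> b, a' \<otimes>\<^bsub>N\<^esub> b'])"
      by (intro transfer) (auto simp: rel_defs)
    then show ?thesis
      using k l approxD[of a a' ?m] approxD[of b b' ?m] assms carr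
        mult_mem[of a b] mult_mem[of a' b'] by simp
  qed
  then show ?thesis using assms carr by (simp add: approx_iff mult_closed)
qed

section \<open>Hull operations on representatives\<close>

abbreviation H :: "(complex, real, 'w set) cstar" where
  "H \<equiv> nonstandard_hull U M"

text \<open>The hull operation is a definite description over all finite representatives;
  \<open>approx_adj\<close> makes the result independent of the choice.\<close>

lemma hull_adj:
  assumes a: "a \<in> Fin U M"
  shows "adj H (hat U M a) = hat U M (adj N a)"
proof -
  have well_defined: "hat U M (adj N a') = hat U M (adj N a)"
    if "a' \<in> Fin U M" "hat U M a = hat U M a'" for a'
    using that a by (metis Fin_carrier adj_closed approx_adj hat_eq_iff)
  show ?thesis
    unfolding nonstandard_hull_def cstar.simps module.simps ring.simps monoid.simps
  proof (rule the_equality, goal_cases)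
    case 1
    show ?case using a by blast
  next
    case (2 Z)
    then show ?case by (metis well_defined)
  qed
qed

lemma hull_mult:
  assumes a: "a \<in> Fin U M" "b \<in> Fin U M"
  shows "hat U M a \<otimes>\<^bsub>H\<^esub> hat U M b = hat U M (a \<otimes>\<^bsub>N\<^esub> b)"
proof -
  have well_defined: "hat U M (a' \<otimes>\<^bsub>N\<^esub> b') = hat U M (a \<otimes>\<^bsub>N\<^esub> b)"
    if "a' \<in> Fin U M" "hat U M a = hat U M a'" "b' \<in> Fin U M" "hat U M b = hat U M b'" for a' b'
    using that a by (metis Fin_carrier mult_closed approx_mult hat_eq_iff)
  show ?thesis
    unfolding nonstandard_hull_def cstar.simps module.simps ring.simps monoid.simps
  proof (rule the_equality, goal_cases)
    case 1
    show ?case using a by blast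
  next
    case (2 Z)
    then show ?case by (metis well_defined)
  qed
qed

lemma hull_carrier: "X \<in> carrier H \<longleftrightarrow> (\<exists>a\<in>Fin U M. X = hat U M a)"
  by (auto simp: nonstandard_hull_def)

section \<open>Internal projections and partial isometries\<close>

text \<open>Satisfying the equations of a projection in the external record \<open>N\<close> amounts
  to belonging to the extension of the relation \<open>projection\<close>. This allows theorems on
  C*-algebras to be transferred.\<close>

lemma projection_iff: "projection N p \<longleftrightarrow> [M, p] \<in> star_rel U (rel1 projection)"
proof -
  have "[M, p] \<in> star_rel U (rel1 projection) \<longleftrightarrow> adj N p = p \<and> p \<otimes>\<^bsub>N\<^esub> p = p" if p: "p \<in> carrier N"
  proof -
    have "sat (star_rel U)
        (FImp (FRel (rel2 (\<lambda>A x y. y = adj A x)) [0, 1, 2])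
          (FImp (FRel (rel3 (\<lambda>A x y z. z = x \<otimes>\<^bsub>A\<^esub> y)) [0, 1, 1, 3])
            (FIff (FRel (rel1 projection) [0, 1]) (FAnd (FEq 2 1) (FEq 3 1)))))
        ((!) [M, p, adj N p, p \<otimes>\<^bsub>N\<^esub> p])"
      by (rule transfer) (auto simp: rel_defs projection_def)
    then show ?thesis using adj_mem[OF p] mult_mem[OF p p] by simp
  qed
  then show ?thesis using rel1_carrier[of p projection] by (auto simp: projection_def)
qed

lemma partial_isometry_iff: "partial_isometry N u \<longleftrightarrow> [M, u] \<in> star_rel U (rel1 partial_isometry)"
proof -
  have "[M, u] \<in> star_rel U (rel1 partial_isometry) \<longleftrightarrow> projection N (adj N u \<otimes>\<^bsub>N\<^esub> u)"
    if u: "u \<in> carrier N"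
  proof -
    have "sat (star_rel U)
        (FImp (FRel (rel2 (\<lambda>A x y. y = adj A x)) [0, 1, 2])
          (FImp (FRel (rel3 (\<lambda>A x y z. z = x \<otimes>\<^bsub>A\<^esub> y)) [0, 2, 1, 3])
            (FIff (FRel (rel1 partial_isometry) [0, 1]) (FRel (rel1 projection) [0, 3]))))
        ((!) [M, u, adj N u, adj N u \<otimes>\<^bsub>N\<^esub> u])"
      by (rule transfer) (auto simp: rel_defs partial_isometry_def)
    then show ?thesis
      using adj_mem[OF u] mult_mem[OF adj_closed[OF u] u] by (simp add: projection_iff)
  qed
  then show ?thesis using rel1_carrier[of u partial_isometry] by (auto simp: partial_isometry_def)
qed

text \<open>\<open>partial_isometry\<close> asks only that \<open>u* u\<close> be a projection;
  equivalence also requires this of \<open>u u*\<close>, and it follows by transfer.\<close>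

lemma internal_partial_isometry_mult_adj:
  assumes "partial_isometry N u"
  shows "projection N (u \<otimes>\<^bsub>N\<^esub> adj N u)"
proof -
  have u: "u \<in> carrier N" using assms by (simp add: partial_isometry_def)
  have "sat (star_rel U)
      (FImp (FRel (rel1 partial_isometry) [0, 1])
        (FImp (FRel (rel2 (\<lambda>A x y. y = adj A x)) [0, 1, 2])
          (FImp (FRel (rel3 (\<lambda>A x y z. z = x \<otimes>\<^bsub>A\<^esub> y)) [0, 1, 2, 3])
            (FRel (rel1 projection) [0, 3]))))
      ((!) [M, u, adj N u, u \<otimes>\<^bsub>N\<^esub> adj N u])"
    by (rule transfer) (auto simp: rel_defs cstar_algebra.partial_isometry_mult_adj)
  then show ?thesis
    using assms adj_mem[OF u] mult_mem[OF u adj_closed[OF u]]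
    by (simp add: projection_iff partial_isometry_iff)
qed

section \<open>Lifting from the hull\<close>

lemma partial_isometry_approx_if_hull:
  assumes v: "v \<in> Fin U M" and pi: "partial_isometry H (hat U M v)"
  shows "\<exists>u. partial_isometry N u \<and> approx U M u v"
proof -
  let ?b = "adj N v" and ?D = "\<lambda>n::nat. rel2 (\<lambda>A x y. alg_norm A (x \<ominus>\<^bsub>A\<^esub> y) < 1 / real n)"
  let ?c = "?b \<otimes>\<^bsub>N\<^esub> v"
  let ?d = "?c \<otimes>\<^bsub>N\<^esub> ?c"
  let ?J = "rel2 (\<lambda>A x y. y = adj A x)" and ?P = "rel3 (\<lambda>A x y z. z = x \<otimes>\<^bsub>A\<^esub> y)"
  txt \<open>The square-root estimate is transferred along with the existence of \<open>u\<close>, so that one \<open>u\<close>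
    is within \<open>1 / n\<close> of \<open>v\<close> for all standard \<open>n\<close> at once.\<close>
  let ?E = "rel2 (\<lambda>A u v. partial_isometry A u \<and>
    alg_norm A (u \<ominus>\<^bsub>A\<^esub> v) \<le> 8 * sqrt (cstar_algebra.defect A v))"
  have fin: "?b \<in> Fin U M" "?c \<in> Fin U M" "?d \<in> Fin U M"
    using v by (simp_all add: Fin_adj Fin_mult)
  have mem: "[M, v, ?b] \<in> star_rel U ?J" "[M, ?b, v, ?c] \<in> star_rel U ?P"
    "[M, ?c, ?c, ?d] \<in> star_rel U ?P"
    using v fin by (simp_all add: adj_mem mult_mem Fin_carrier)
  have "hat U M ?d = hat U M ?c"
    using pi v fin by (simp add: partial_isometry_def projection_def hull_adj hull_mult)
  then have dc: "approx U M ?d ?c"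
    using fin by (simp add: hat_eq_iff Fin_carrier)
  have D: "[M, ?d, ?c] \<in> star_rel U (?D n)" if "1 \<le> n" for n
    using approxD[OF dc _ _ that] fin by (simp add: Fin_carrier)
  \<comment> \<open>The difference of \<open>?d\<close> and \<open>?c\<close> has infinitesimal
    norm, in particular below the threshold 1/1000 of \<open>partial_isometry_near\<close>.\<close>
  have "sat (star_rel U)
      (FImp (FRel ?J [0, 1, 2]) (FImp (FRel ?P [0, 2, 1, 3]) (FImp (FRel ?P [0, 3, 3, 4])
        (FImp (FRel (?D 1000) [0, 4, 3]) (FEx 5 (FRel ?E [0, 5, 1]))))))
      ((!) [M, v, ?b, ?c, ?d])"
  proof (rule transfer)
    have "\<exists>u. u \<in> carrier A \<and> partial_isometry A u \<and>
        alg_norm A (u \<ominus>\<^bsub>A\<^esub> x) \<le> 8 * sqrt (cstar_algebra.defect A x)"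
      if "cstar_algebra A" "x \<in> carrier A"
        "alg_norm A ((adj A x \<otimes>\<^bsub>A\<^esub> x) \<otimes>\<^bsub>A\<^esub> (adj A x \<otimes>\<^bsub>A\<^esub> x) \<ominus>\<^bsub>A\<^esub> (adj A x \<otimes>\<^bsub>A\<^esub> x)) < 1 / real 1000"
      for A :: "(complex, real, 'a) cstar" and x
      using cstar_algebra.partial_isometry_near[of A x] that
      by (auto simp: cstar_algebra.defect_def partial_isometry_def)
    then show "sat (\<lambda>R. R) (FImp (FRel ?J [0, 1, 2]) (FImp (FRel ?P [0, 2, 1, 3])
        (FImp (FRel ?P [0, 3, 3, 4])
        (FImp (FRel (?D 1000) [0, 4, 3]) (FEx 5 (FRel ?E [0, 5, 1])))))) e" for e
      by (auto simp: rel_defs)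
  qed
  then obtain u where u: "[M, u, v] \<in> star_rel U ?E"
    using mem D[of 1000] by auto
  have uc: "u \<in> carrier N" using u by (rule rel2_carrier)
  have "sat (star_rel U) (FImp (FRel ?E [0, 1, 2]) (FRel (rel1 partial_isometry) [0, 1])) ((!) [M, u, v])"
    by (rule transfer) (auto simp: rel_defs)
  then have "partial_isometry N u" using u by (simp add: partial_isometry_iff)
  moreover have "[M, u, v] \<in> star_rel U (?D n)" if n: "1 \<le> n" for n
  proof -
    \<comment> \<open>A defect below the inverse square of \<open>10 * n\<close> has a square root
      below \<open>1 / (10 * n)\<close>, and 8 times this is still below
      \<open>1 / n\<close>.\<close>
    have "alg_norm A (y \<ominus>\<^bsub>A\<^esub> x) < 1 / real n"
      if "cstar_algebra A" "x \<in> carrier A"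
        "alg_norm A (y \<ominus>\<^bsub>A\<^esub> x) \<le> 8 * sqrt (cstar_algebra.defect A x)"
        "alg_norm A ((adj A x \<otimes>\<^bsub>A\<^esub> x) \<otimes>\<^bsub>A\<^esub> (adj A x \<otimes>\<^bsub>A\<^esub> x) \<ominus>\<^bsub>A\<^esub> (adj A x \<otimes>\<^bsub>A\<^esub> x)) < 1 / real ((10 * n)\<^sup>2)"
      for A :: "(complex, real, 'a) cstar" and x y
    proof -
      have "sqrt (cstar_algebra.defect A x) \<le> sqrt ((1 / real (10 * n))\<^sup>2)"
        using that by (simp add: cstar_algebra.defect_def power_divide)
      also have "\<dots> = 1 / real (10 * n)" by simp
      finally have "alg_norm A (y \<ominus>\<^bsub>A\<^esub> x) \<le> 8 * (1 / real (10 * n))" using that(3) by linarith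
      also have "\<dots> < 1 / real n" using n by (simp add: field_simps)
      finally show ?thesis .
    qed
    then have "sat (star_rel U)
        (FImp (FRel ?J [0, 1, 2]) (FImp (FRel ?P [0, 2, 1, 3]) (FImp (FRel ?P [0, 3, 3, 4])
          (FImp (FRel (?D ((10 * n)\<^sup>2)) [0, 4, 3]) (FImp (FRel ?E [0, 5, 1]) (FRel (?D n) [0, 5, 1]))))))
        ((!) [M, v, ?b, ?c, ?d, u])"
      by (intro transfer) (auto simp: rel_defs)
    then show ?thesis using mem D[of "(10 * n)\<^sup>2"] u n by simp
  qed
  ultimately show ?thesis using uc v by (auto simp: approx_iff Fin_carrier)
qed

text \<open>The lift \<open>p\<close> may fail to be self-adjoint or idempotent. For a partial
  isometry \<open>u\<close> close to it, \<open>u* u\<close> is a projection, and its class is that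
  of \<open>p* p\<close>, which equals that of \<open>p\<close> in the hull.\<close>

lemma hat_eq_projection_if_hull:
  assumes p: "p \<in> Fin U M" and proj: "projection H (hat U M p)"
  shows "\<exists>q. projection N q \<and> hat U M p = hat U M q"
proof -
  have pp: "adj H (hat U M p) \<otimes>\<^bsub>H\<^esub> hat U M p = hat U M p"
    using proj by (simp add: projection_def)
  then have "partial_isometry H (hat U M p)"
    using proj by (simp add: partial_isometry_def projection_def)
  then obtain u where u: "partial_isometry N u" "approx U M u p"
    using partial_isometry_approx_if_hull p by blast
  have uc: "u \<in> carrier N" using u by (simp add: partial_isometry_def)
  have fin: "u \<in> Fin U M" using Fin_approx[OF p uc u(2)] .
  have "hat U M u = hat U M p" using u uc p by (simp add: hat_eq_iff Fin_carrier)
  moreover have "hat U M (adj N u \<otimes>\<^bsub>N\<^esub> u) = adj H (hat U M u) \<otimes>\<^bsub>H\<^esub> hat U M u"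
    using fin by (simp add: hull_adj hull_mult Fin_adj)
  ultimately have "hat U M (adj N u \<otimes>\<^bsub>N\<^esub> u) = hat U M p"
    using pp by simp
  then show ?thesis using u by (auto simp: partial_isometry_def)
qed

text \<open>A single lift \<open>u\<close> of the implementing partial isometry yields both
  projections together with their equivalence; lifting \<open>P\<close> and \<open>Q\<close>
  separately would give no link between the lifts.\<close>

lemma hat_eq_mvn_equivalent_if_hull:
  assumes "mvn_equivalent H P Q"
  shows "\<exists>p q. projection N p \<and> projection N q \<and> hat U M p = P \<and> hat U M q = Q \<and>
    mvn_equivalent N p q"
proof -
  obtain W where W: "partial_isometry H W" "adj H W \<otimes>\<^bsub>H\<^esub> W = P" "W \<otimes>\<^bsub>H\<^esub> adj H W = Q"
    using assms by (auto simp: mvn_equivalent_def)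
  then obtain w where w: "w \<in> Fin U M" "W = hat U M w"
    by (auto simp: partial_isometry_def hull_carrier)
  obtain u where u: "partial_isometry N u" "approx U M u w"
    using partial_isometry_approx_if_hull w W by blast
  have uc: "u \<in> carrier N" using u by (simp add: partial_isometry_def)
  have fin: "u \<in> Fin U M" using Fin_approx[OF w(1) uc u(2)] .
  have "hat U M u = W" using u uc w by (simp add: hat_eq_iff Fin_carrier)
  moreover have "hat U M (adj N u \<otimes>\<^bsub>N\<^esub> u) = adj H (hat U M u) \<otimes>\<^bsub>H\<^esub> hat U M u"
    "hat U M (u \<otimes>\<^bsub>N\<^esub> adj N u) = hat U M u \<otimes>\<^bsub>H\<^esub> adj H (hat U M u)"
    using fin by (simp_all add: hull_adj hull_mult Fin_adj)
  ultimately have "hat U M (adj N u \<otimes>\<^bsub>N\<^esub> u) = P" "hat U M (u \<otimes>\<^bsub>N\<^esub> adj N u) = Q"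
    using W by simp_all
  moreover have "projection N (adj N u \<otimes>\<^bsub>N\<^esub> u)"
    using u by (simp add: partial_isometry_def)
  moreover have "mvn_equivalent N (adj N u \<otimes>\<^bsub>N\<^esub> u) (u \<otimes>\<^bsub>N\<^esub> adj N u)"
    using u by (auto simp: mvn_equivalent_def)
  ultimately show ?thesis using internal_partial_isometry_mult_adj[OF u(1)] by blast
qed

end

theorem theorem17:
  fixes U :: "('a, 'v, 'w) extension" and \<kappa> :: "'k rel" and M :: 'w
  assumes "nonstandard_universe U"
    and "uncountable_cardinal \<kappa>" and "saturated U \<kappa>"
    and "internal_cstar_algebra U M"
  shows "(\<forall>v\<in>Fin U M. partial_isometry (nonstandard_hull U M) (hat U M v) \<longrightarrow>
            (\<exists>u. partial_isometry (internal_alg U M) u \<and> approx U M u v)) \<and>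
         (\<forall>p\<in>Fin U M. projection (nonstandard_hull U M) (hat U M p) \<longrightarrow>
            (\<exists>q. projection (internal_alg U M) q \<and> hat U M p = hat U M q)) \<and>
         (\<forall>p\<^sub>0\<in>Fin U M. \<forall>q\<^sub>0\<in>Fin U M.
            projection (nonstandard_hull U M) (hat U M p\<^sub>0) \<and> projection (nonstandard_hull U M) (hat U M q\<^sub>0) \<and>
            mvn_equivalent (nonstandard_hull U M) (hat U M p\<^sub>0) (hat U M q\<^sub>0) \<longrightarrow>
            (\<exists>p q. projection (internal_alg U M) p \<and> projection (internal_alg U M) q \<and>
               hat U M p = hat U M p\<^sub>0 \<and> hat U M q = hat U M q\<^sub>0 \<and>
               mvn_equivalent (internal_alg U M) p q))"
proof -
  interpret internal_cstar U M
    using assms by unfold_locales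
  show ?thesis
    using partial_isometry_approx_if_hull hat_eq_projection_if_hull hat_eq_mvn_equivalent_if_hull
    by blast
qed

end
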